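(* For all integers $n \geq 1$, $$D_n \equiv (-1)^{n-1} h_{n-1}\, x \pmod{x^2}$$ in $\mathbb{Z}[x]$, where $(h_n)_{n\ge0}=(1,1,2,7,38,295,\ldots)$ is the sequence of normalized median Genocchi numbers.
   Context: **Chord diagrams.** For $n\ge 1$ an $n$-chord diagram is an oriented circle with $2n$ distinct points paired into $n$ disjoint pairs (chords), up to orientation-preserving diffeomorphism of the circle. It is represented by a tuple $((p_i,p_i^* ))_{1\le i\le n}$ with $\{p_1,p_1^*,\ldots,p_n,p_n^*\}=\{1,\ldots,2n\}$, $p_1<\cdots<p_n$ and $p_i<p_i^*$: points on the circle are labelled $1,\ldots,2n$ counterclockwise and $p_i$ is joined to $p_i^*$ (different tuples may represent the same diagram). **The weight $\varphi$.** To each $n$-chord diagram $\mathcal{D}$ one associates $\varphi(\mathcal{D})\in\mathbb{Z}[x]$ recursively: $\varphi=x$ on the unique $1$-chord diagram; for $n\ge2$, pick any chord $a$ of $\mathcal D$ (it is a known result that the value does not depend on the choice) and set $$\varphi(\mathcal{D})=(x-k)\varphi(\mathcal{D}_a)+\sum_{\{i,j\}\subset I_a}\left(\varphi(\mathcal{D}^1_{i,j})-\varphi(\mathcal{D}^2_{i,j})\right),$$ where $\mathcal{D}_a$ is $\mathcal{D}$ with $a$ deleted; $I_a$ is the set of indices of the chords of $\mathcal D$ that cross $a$; $k=\#I_a$; the sum is over two-element subsets of $I_a$; for $i\in I_a$, $q_i$ is the endpoint of chord $i$ lying on one fixed side of $a$ (the same side for all $i \in I_a$) and $q_i^*$ is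 its other endpoint; $\mathcal{D}^1_{i,j}$ (resp. $\mathcal{D}^2_{i,j}$) is obtained from $\mathcal{D}_a$ by replacing the chords $i$ and $j$ by $(q_i,q_j)$ and $(q_i^*,q_j^* )$ (resp. by $(q_i,q_j^* )$ and $(q_j,q_i^* )$). **The polynomials $D_n$.** $\mathcal{D}_n=((i,n+i))_{1\le i\le n}$ is the $n$-chord diagram in which every two chords cross, and $D_n=\varphi(\mathcal{D}_n)$. **Normalized median Genocchi numbers.** The Seidel triangle $(g_{i,j})_{1\le j\le\lceil i/2\rceil}$ is defined by $g_{1,1}=1$ and, for all $p\ge1$, $g_{2p,j}=g_{2p-1,j}+g_{2p,j+1}$ (for $1\le j\le p$) and $g_{2p+1,j}=g_{2p+1,j-1}+g_{2p,j}$ (for $1\le j\le p+1$), where $g_{2p,p+1}=g_{2p+1,0}=0$. The median Genocchi numbers are $H_{2n+1}=g_{2n+2,1}$ for $n\ge0$; it is known that $2^n$ divides $H_{2n+1}$, and $h_n=H_{2n+1}/2^n$. (Known equivalent description: $h_n$ is the number of permutations $\sigma$ of $\{1,\ldots,2n+2\}$ with $\sigma(2i-1)>2i-1$ and $\sigma(2i)<2i$ for $1\le i\le n+1$, and $\sigma^{-1}(2i)<\sigma^{-1}(2i+1)$ for $1\le i\le n$.) *)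

theory Defs
  imports "HOL-Computational_Algebra.Polynomial"
begin

text \<open>
  A chord diagram is encoded by its set of chords, each chord being the set of its two endpoints.
  The points of the oriented circle carry distinct natural numbers as labels, increasing
  counterclockwise from some base point. Only the relative order of the labels matters, so they
  need not be exactly the numbers from 1 to 2n; deleting chords then requires no relabelling.
\<close>

definition chord_diagram :: "nat \<Rightarrow> nat set set \<Rightarrow> bool" where
  "chord_diagram n D \<longleftrightarrow>
     finite D \<and> card D = n \<and> (\<forall>c\<in>D. card c = 2) \<and> pairwise disjnt D"

definition between :: "nat set \<Rightarrow> nat \<Rightarrow> bool" where
  "between a q \<longleftrightarrow> Min a < q \<and> q < Max a"

text \<open>For disjoint chords: one endpoint of \<open>c\<close> lies on each side of \<open>a\<close>.\<close>

definition crosses :: "nat set \<Rightarrow> nat set \<Rightarrow> bool" where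
  "crosses a c \<longleftrightarrow> between a (Min c) \<noteq> between a (Max c)"

definition crossing_chords :: "nat set set \<Rightarrow> nat set \<Rightarrow> nat set set" where
  "crossing_chords D a = {c \<in> D - {a}. crosses a c}"

text \<open>
  The endpoints \<open>q\<close> and \<open>q\<^sup>*\<close> of a chord \<open>c\<close> crossing \<open>a\<close>. The fixed side of \<open>a\<close> is the one
  between its two labels; choosing the other side exchanges \<open>q\<close> and \<open>q\<^sup>*\<close> for all crossing
  chords at once, which leaves both diagrams below unchanged.
\<close>

definition endpt :: "nat set \<Rightarrow> nat set \<Rightarrow> nat" where
  "endpt a c = (if between a (Min c) then Min c else Max c)"

definition endpt_star :: "nat set \<Rightarrow> nat set \<Rightarrow> nat" where
  "endpt_star a c = (if between a (Min c) then Max c else Min c)"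

definition surgery1 :: "nat set set \<Rightarrow> nat set \<Rightarrow> nat set \<Rightarrow> nat set \<Rightarrow> nat set set" where
  "surgery1 D a c d =
     (D - {a, c, d}) \<union> {{endpt a c, endpt a d}, {endpt_star a c, endpt_star a d}}"

definition surgery2 :: "nat set set \<Rightarrow> nat set \<Rightarrow> nat set \<Rightarrow> nat set \<Rightarrow> nat set set" where
  "surgery2 D a c d =
     (D - {a, c, d}) \<union> {{endpt a c, endpt_star a d}, {endpt a d, endpt_star a c}}"

text \<open>
  \<open>weight_value D p\<close>: the polynomial \<open>p\<close> is obtained from \<open>D\<close> by the recursion, for some choice of
  the chord \<open>a\<close> at every step. \<open>P S\<close> and \<open>Q S\<close> are the values for the two surgeries along the
  two-element set \<open>S\<close> of chords crossing \<open>a\<close>.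
\<close>

inductive weight_value :: "nat set set \<Rightarrow> int poly \<Rightarrow> bool" where
  single: "chord_diagram 1 D \<Longrightarrow> weight_value D [:0, 1:]"
| step: "\<lbrakk>chord_diagram n D; n \<ge> 2; a \<in> D;
    weight_value (D - {a}) p;
    \<And>c d. \<lbrakk>c \<in> crossing_chords D a; d \<in> crossing_chords D a; c \<noteq> d\<rbrakk>
      \<Longrightarrow> weight_value (surgery1 D a c d) (P {c, d});
    \<And>c d. \<lbrakk>c \<in> crossing_chords D a; d \<in> crossing_chords D a; c \<noteq> d\<rbrakk>
      \<Longrightarrow> weight_value (surgery2 D a c d) (Q {c, d})\<rbrakk>
    \<Longrightarrow> weight_value D
      (([:0, 1:] - of_nat (card (crossing_chords D a))) * p
       + (\<Sum>S | S \<subseteq> crossing_chords D a \<and> card S = 2. P S - Q S))"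

text \<open>The value does not depend on the choices of chords (Chmutov and Varchenko).\<close>

definition weight :: "nat set set \<Rightarrow> int poly" where
  "weight D = (THE p. weight_value D p)"

definition complete_diagram :: "nat \<Rightarrow> nat set set" where
  "complete_diagram n = (\<lambda>i. {i, n + i}) ` {1..n}"

definition D_poly :: "nat \<Rightarrow> int poly" where
  "D_poly n = weight (complete_diagram n)"

text \<open>The Seidel triangle, extended by 0 outside the range of indices
  \<open>1 \<le> j \<le> \<lceil>i/2\<rceil>\<close>.\<close>

function seidel :: "nat \<Rightarrow> nat \<Rightarrow> nat" where
  "seidel i j =
     (if j = 0 \<or> j > (i + 1) div 2 then 0
      else if i = 1 then 1
      else if even i then seidel (i - 1) j + seidel i (j + 1)
      else seidel i (j - 1) + seidel (i - 1) j)"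
  by pat_completeness auto
termination
  by (relation "measures [fst, \<lambda>(i, j). if even i then i - j else j]") auto

declare seidel.simps [simp del]

text \<open>\<open>median_genocchi n\<close> is \<open>H\<^bsub>2n+1\<^esub>\<close>; it is divisible by \<open>2 ^ n\<close>.\<close>

definition median_genocchi :: "nat \<Rightarrow> nat" where
  "median_genocchi n = seidel (2 * n + 2) 1"

definition normalized_median_genocchi :: "nat \<Rightarrow> nat" where
  "normalized_median_genocchi n = median_genocchi n div 2 ^ n"

end

theory Submission
  imports Defs "HOL-Library.FuncSet"
begin

text \<open>
  The recursion is that of the weight system of the Lie algebra sl(2), in its form so(3). Label every
  chord by one of three generators \<open>J\<^sub>1, J\<^sub>2, J\<^sub>3\<close> with \<open>[J\<^sub>1, J\<^sub>2] = \<i> J\<^sub>3\<close> and cyclic permutations,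
  multiply the labels of the endpoints in the order of the points, and sum over all labellings. In a
  module on which the Casimir element \<open>\<Sum>a. J\<^sub>a J\<^sub>a\<close> acts as \<open>x\<close>, moving one endpoint of a chord \<open>a\<close>
  across the points between its ends produces commutators, and the contraction rule of two
  structure tensors, \<open>\<Sum>a. \<epsilon> a b g * \<epsilon> a c d = [b = c] [g = d] - [b = d] [g = c]\<close>, turns these into
  exactly the two surgeries (lemma \<open>contract_letters\<close>). So the state sum obeys the recursion for
  every choice of \<open>a\<close> (\<open>diagram_sum_recursion\<close>). A module of highest weight \<open>l\<close> has \<open>x = l (l + 1)\<close>,
  which takes every complex value, so all polynomials reachable by the recursion agree
  (\<open>weight_value_unique\<close>), and \<open>D\<^sub>n\<close> at \<open>l (l + 1)\<close> is a sum over words \<open>w\<close> of length \<open>n\<close> of the vacuum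
  expectation of \<open>w w\<close>.

  The operator \<open>\<Sum>w. w \<otimes> w\<close> is the \<open>n\<close>-th power of \<open>A = \<Sum>a. J\<^sub>a \<otimes> J\<^sub>a\<close>. On polynomials in two variables
  \<open>y, z\<close>, \<open>A\<close> is a second order operator that acts on \<open>binomial(k, i) (z - y)^i y^(k-i)\<close> by
  a bidiagonal matrix which does not depend on \<open>k\<close>. Starting from \<open>y^k\<close>, reading off the
  coefficient of \<open>z^k\<close> and summing over \<open>k\<close> leaves the sum over \<open>i\<close> of the entries \<open>t\<^sub>n\<^sub>,\<^sub>i(l)\<close> of the \<open>n\<close>-th power
  (\<open>pairing_eq\<close>, \<open>eval_weight_value_complete\<close>). As \<open>x = l + l^2\<close>, the coefficient of \<open>x\<close> in \<open>D\<^sub>n\<close>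
  is that of \<open>l\<close>, for which the recursion becomes
  \<open>a\<^sub>n\<^sub>+\<^sub>1\<^sub>,\<^sub>i = i (i - 1) / 2 * (a\<^sub>n\<^sub>,\<^sub>i - a\<^sub>n\<^sub>,\<^sub>i\<^sub>-\<^sub>1)\<close>.

  Finally, let \<open>L\<close> be the linear functional on polynomials with \<open>L (F(v) + F(v + 1)) = F'(0)\<close>. Its
  values on \<open>v^a (v + 1)^b\<close> satisfy Pascal's recursion and a reflection symmetry, and up to a factor
  2 and signs they fill the Seidel triangle (\<open>seidel_moment\<close>). The numbers \<open>a\<^sub>n\<^sub>,\<^sub>i\<close> expand powers of \<open>v (v + 1) / 2\<close> in
  a Newton type basis on which \<open>L\<close>, suitably weighted, is constant; so \<open>\<Sum>i. a\<^sub>n\<^sub>,\<^sub>i\<close> is, up to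
  sign, a median Genocchi number divided by a power of two (\<open>sum_linear_coeff\<close>).
\<close>

section \<open>Words in the generators of so(3)\<close>

datatype axis = Ax1 | Ax2 | Ax3

lemma UNIV_axis: "UNIV = {Ax1, Ax2, Ax3}"
  using axis.exhaust by auto

instance axis :: finite
  by standard (simp add: UNIV_axis)

lemma sum_axis: "(\<Sum>a\<in>UNIV. f a) = f Ax1 + f Ax2 + (f Ax3 :: 'a :: comm_monoid_add)"
  by (simp add: UNIV_axis add.assoc)

text \<open>The structure constants: \<open>[J\<^sub>a, J\<^sub>b] = \<i> \<Sum>g. eps a b g J\<^sub>g\<close>.\<close>

fun eps :: "axis \<Rightarrow> axis \<Rightarrow> axis \<Rightarrow> complex" where
  "eps Ax1 Ax2 Ax3 = 1"
| "eps Ax2 Ax3 Ax1 = 1"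
| "eps Ax3 Ax1 Ax2 = 1"
| "eps Ax2 Ax1 Ax3 = -1"
| "eps Ax3 Ax2 Ax1 = -1"
| "eps Ax1 Ax3 Ax2 = -1"
| "eps _ _ _ = 0"

text \<open>The only fact about so(3) that goes beyond a general metrized Lie algebra. The two terms on the right
  become the two surgeries.\<close>

lemma eps_contract:
  "(\<Sum>a\<in>UNIV. \<Sum>g\<in>UNIV. \<Sum>d\<in>UNIV. eps a b g * eps a c d * f g d)
     = (if b = c then \<Sum>d\<in>UNIV. f d d else 0) - f c b"
  by (cases b; cases c) (simp_all add: sum_axis)

text \<open>A linear functional on the universal enveloping algebra, given on words, that sees the Casimir
  element as the scalar \<open>x\<close>. Nothing else about a representation enters the recursion.\<close>

locale so3_functional =
  fixes \<psi> :: "axis list \<Rightarrow> complex" and x :: complex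
  assumes commutator: "\<psi> (u @ a # b # w) =
      \<psi> (u @ b # a # w) + \<i> * (\<Sum>g\<in>UNIV. eps a b g * \<psi> (u @ g # w))"
    and casimir: "(\<Sum>a\<in>UNIV. \<psi> (u @ a # a # w)) = x * \<psi> (u @ w)"
    and Nil [simp]: "\<psi> [] = 1"
begin

text \<open>A product rule for the commutator of a letter with a word. The word is the image of a list of
  distinct points under a labelling \<open>s\<close>, so that changing one letter is updating \<open>s\<close> at one point.\<close>

lemma move_letter:
  assumes "distinct xs"
  shows "\<psi> (u @ a # map s xs @ w) = \<psi> (u @ map s xs @ a # w)
     + \<i> * (\<Sum>q\<in>set xs. \<Sum>d\<in>UNIV. eps a (s q) d * \<psi> (u @ map (s(q := d)) xs @ w))"
  using assms
proof (induction xs arbitrary: u)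
  case Nil
  then show ?case by simp
next
  case (Cons p xs)
  have 1: "map (s(p := d)) (p # xs) = d # map s xs" for d
    using Cons.prems by simp
  have 2: "map (s(q := d)) (p # xs) = s p # map (s(q := d)) xs" if "q \<in> set xs" for q d
    using Cons.prems that by auto
  have "\<psi> (u @ a # map s (p # xs) @ w) = \<psi> ((u @ [s p]) @ a # map s xs @ w)
     + \<i> * (\<Sum>d\<in>UNIV. eps a (s p) d * \<psi> (u @ map (s(p := d)) (p # xs) @ w))"
    using commutator[of u a "s p" "map s xs @ w"] unfolding 1 by simp
  also have "\<psi> ((u @ [s p]) @ a # map s xs @ w) = \<psi> ((u @ [s p]) @ map s xs @ a # w)
     + \<i> * (\<Sum>q\<in>set xs. \<Sum>d\<in>UNIV. eps a (s q) d * \<psi> ((u @ [s p]) @ map (s(q := d)) xs @ w))"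
    by (rule Cons.IH) (use Cons.prems in simp)
  also have "(\<Sum>q\<in>set xs. \<Sum>d\<in>UNIV. eps a (s q) d * \<psi> ((u @ [s p]) @ map (s(q := d)) xs @ w))
     = (\<Sum>q\<in>set xs. \<Sum>d\<in>UNIV. eps a (s q) d * \<psi> (u @ map (s(q := d)) (p # xs) @ w))"
    by (intro sum.cong refl) (simp add: 2 del: list.map)
  finally have "\<psi> (u @ a # map s (p # xs) @ w) = \<psi> (u @ map s (p # xs) @ a # w)
     + \<i> * ((\<Sum>d\<in>UNIV. eps a (s p) d * \<psi> (u @ map (s(p := d)) (p # xs) @ w))
       + (\<Sum>q\<in>set xs. \<Sum>d\<in>UNIV. eps a (s q) d * \<psi> (u @ map (s(q := d)) (p # xs) @ w)))"
    by (simp only: append_assoc append.simps list.map distrib_left add_ac)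
  moreover have "(\<Sum>q\<in>set (p # xs). f q) = f p + (\<Sum>q\<in>set xs. f q)" for f :: "'a \<Rightarrow> complex"
    using Cons.prems by simp
  ultimately show ?case by (simp only:)
qed

text \<open>The contribution of two points between the ends of the contracted pair: joining \<open>p\<close> and \<open>q\<close> by a
  new label, minus exchanging their labels.\<close>

definition pair_term where
  "pair_term u w xs s p q =
     (if s p = s q then \<Sum>d\<in>UNIV. \<psi> (u @ map (s(p := d, q := d)) xs @ w) else 0)
     - \<psi> (u @ map (s(p := s q, q := s p)) xs @ w)"

lemma pair_term_commute: "p \<noteq> q \<Longrightarrow> pair_term u w xs s p q = pair_term u w xs s q p"
  unfolding pair_term_def by (simp add: fun_upd_twist)

text \<open>The commutators here pair up into brackets of two letters, and the double contraction of the
  structure constants is twice the identity.\<close>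

lemma contract_eps_diag:
  "\<i> * (\<Sum>a\<in>UNIV. \<Sum>g\<in>UNIV. eps a b g * \<psi> (u @ g # a # w)) = - \<psi> (u @ b # w)"
proof -
  have "\<psi> (u @ a # c # w) - \<psi> (u @ c # a # w) = \<i> * (\<Sum>g\<in>UNIV. eps a c g * \<psi> (u @ g # w))" for a c
    using commutator[of u a c w] by simp
  from this[of Ax1 Ax2] this[of Ax2 Ax3] this[of Ax3 Ax1]
  have "\<i> * (\<psi> (u @ Ax1 # Ax2 # w) - \<psi> (u @ Ax2 # Ax1 # w)) = - \<psi> (u @ Ax3 # w)"
    "\<i> * (\<psi> (u @ Ax2 # Ax3 # w) - \<psi> (u @ Ax3 # Ax2 # w)) = - \<psi> (u @ Ax1 # w)"
    "\<i> * (\<psi> (u @ Ax3 # Ax1 # w) - \<psi> (u @ Ax1 # Ax3 # w)) = - \<psi> (u @ Ax2 # w)"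
    by (simp_all add: sum_axis)
  then show ?thesis
    by (cases b) (simp_all add: sum_axis algebra_simps)
qed

text \<open>Induction on the word between the contracted letters: moving the first copy of \<open>a\<close> past the next
  letter gives the contraction over a shorter word and a commutator. Moving the second copy of \<open>a\<close> back
  next to it and using the two contraction rules gives one new pair term for every later point.
  Ordered pairs, hence the factor 2, avoid any reference to the order of the points.\<close>

lemma contract_letters:
  assumes "distinct xs"
  shows "2 * (\<Sum>a\<in>UNIV. \<psi> (u @ a # map s xs @ a # w)) =
     2 * (x - of_nat (length xs)) * \<psi> (u @ map s xs @ w)
     + (\<Sum>p\<in>set xs. \<Sum>q\<in>set xs - {p}. pair_term u w xs s p q)"
  using assms
proof (induction xs arbitrary: u)
  case Nil
  then show ?case using casimir[of u w] by simp
next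
  case (Cons p xs)
  have dist: "distinct xs" and p: "p \<notin> set xs" using Cons.prems by auto
  let ?Y = "map s xs" and ?b = "s p"
  have map_upd: "map (s(p := d)) xs = map s xs" "map (t(p := d)) xs = map t xs" for d t
    using p by auto
  have pt: "pair_term u w (p # xs) s q r = pair_term (u @ [?b]) w xs s q r"
    if "q \<in> set xs" "r \<in> set xs" for q r
    using p that unfolding pair_term_def by auto
  have ptp: "pair_term u w (p # xs) s p q =
      (if ?b = s q then \<Sum>d\<in>UNIV. \<psi> (u @ d # map (s(q := d)) xs @ w) else 0)
      - \<psi> (u @ s q # map (s(q := ?b)) xs @ w)" if "q \<in> set xs" for q
  proof -
    have "p \<noteq> q" using that p by auto
    then have "s(p := d, q := d') = s(q := d', p := d)" for d d'
      by (simp add: fun_upd_twist)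
    then show ?thesis
      unfolding pair_term_def using \<open>p \<noteq> q\<close> by (simp add: map_upd)
  qed
  have A: "(\<Sum>a\<in>UNIV. \<psi> (u @ a # ?b # ?Y @ a # w)) =
     (\<Sum>a\<in>UNIV. \<psi> ((u @ [?b]) @ a # ?Y @ a # w))
     + \<i> * (\<Sum>a\<in>UNIV. \<Sum>g\<in>UNIV. eps a ?b g * \<psi> (u @ g # ?Y @ a # w))"
    by (subst commutator) (simp add: sum.distrib sum_distrib_left)
  have B: "\<psi> (u @ g # ?Y @ a # w) = \<psi> (u @ g # a # ?Y @ w)
     - \<i> * (\<Sum>q\<in>set xs. \<Sum>d\<in>UNIV. eps a (s q) d * \<psi> (u @ g # map (s(q := d)) xs @ w))" for a g
    using move_letter[OF dist, of "u @ [g]" a s w] by simp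
  have "\<i> * (\<Sum>a\<in>UNIV. \<Sum>g\<in>UNIV. eps a ?b g * \<psi> (u @ g # ?Y @ a # w))
     = \<i> * (\<Sum>a\<in>UNIV. \<Sum>g\<in>UNIV. eps a ?b g * \<psi> (u @ g # a # ?Y @ w))
     + (\<Sum>a\<in>UNIV. \<Sum>g\<in>UNIV. \<Sum>q\<in>set xs. \<Sum>d\<in>UNIV.
          eps a ?b g * eps a (s q) d * \<psi> (u @ g # map (s(q := d)) xs @ w))"
  proof -
    have *: "\<i> * (\<Sum>a\<in>UNIV. \<Sum>g\<in>UNIV. e a g * (y a g - \<i> * z a g))
       = \<i> * (\<Sum>a\<in>UNIV. \<Sum>g\<in>UNIV. e a g * y a g) + (\<Sum>a\<in>UNIV. \<Sum>g\<in>UNIV. e a g * z a g)"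
      for e y z :: "axis \<Rightarrow> axis \<Rightarrow> complex"
      by (simp add: sum_axis algebra_simps)
    show ?thesis
      unfolding B * by (simp only: sum_distrib_left mult.assoc)
  qed
  also have "(\<Sum>a\<in>UNIV. \<Sum>g\<in>UNIV. \<Sum>q\<in>set xs. \<Sum>d\<in>UNIV.
          eps a ?b g * eps a (s q) d * \<psi> (u @ g # map (s(q := d)) xs @ w))
     = (\<Sum>q\<in>set xs. \<Sum>a\<in>UNIV. \<Sum>g\<in>UNIV. \<Sum>d\<in>UNIV.
          eps a ?b g * eps a (s q) d * \<psi> (u @ g # map (s(q := d)) xs @ w))"
    by (subst (2) sum.swap, subst sum.swap) (rule refl)
  also have "\<dots> = (\<Sum>q\<in>set xs. pair_term u w (p # xs) s p q)"
    by (intro sum.cong refl) (simp only: eps_contract ptp)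
  finally have C: "\<i> * (\<Sum>a\<in>UNIV. \<Sum>g\<in>UNIV. eps a ?b g * \<psi> (u @ g # ?Y @ a # w))
     = - \<psi> (u @ ?b # ?Y @ w) + (\<Sum>q\<in>set xs. pair_term u w (p # xs) s p q)"
    unfolding contract_eps_diag .
  have "(\<Sum>q\<in>set (p # xs). \<Sum>r\<in>set (p # xs) - {q}. pair_term u w (p # xs) s q r)
     = (\<Sum>r\<in>set xs. pair_term u w (p # xs) s p r)
      + (\<Sum>q\<in>set xs. \<Sum>r\<in>insert p (set xs - {q}). pair_term u w (p # xs) s q r)"
  proof -
    have "set (p # xs) - {p} = set xs" using p by auto
    moreover have "set (p # xs) - {q} = insert p (set xs - {q})" if "q \<in> set xs" for q
      using p that by auto
    ultimately show ?thesis using p by (simp cong: sum.cong)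
  qed
  also have "(\<Sum>q\<in>set xs. \<Sum>r\<in>insert p (set xs - {q}). pair_term u w (p # xs) s q r)
     = (\<Sum>q\<in>set xs. pair_term u w (p # xs) s p q
         + (\<Sum>r\<in>set xs - {q}. pair_term (u @ [?b]) w xs s q r))"
  proof (intro sum.cong refl)
    fix q assume q: "q \<in> set xs"
    have "(\<Sum>r\<in>set xs - {q}. pair_term u w (p # xs) s q r)
        = (\<Sum>r\<in>set xs - {q}. pair_term (u @ [?b]) w xs s q r)"
      by (intro sum.cong refl pt q) auto
    moreover have "pair_term u w (p # xs) s q p = pair_term u w (p # xs) s p q"
      by (rule pair_term_commute) (use p q in auto)
    ultimately show "(\<Sum>r\<in>insert p (set xs - {q}). pair_term u w (p # xs) s q r)
      = pair_term u w (p # xs) s p q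
         + (\<Sum>r\<in>set xs - {q}. pair_term (u @ [?b]) w xs s q r)"
      using p by simp
  qed
  finally have D: "(\<Sum>q\<in>set (p # xs). \<Sum>r\<in>set (p # xs) - {q}. pair_term u w (p # xs) s q r)
     = 2 * (\<Sum>r\<in>set xs. pair_term u w (p # xs) s p r)
       + (\<Sum>q\<in>set xs. \<Sum>r\<in>set xs - {q}. pair_term (u @ [?b]) w xs s q r)"
    by (simp add: sum.distrib)
  have E: "2 * (\<Sum>a\<in>UNIV. \<psi> ((u @ [?b]) @ a # ?Y @ a # w)) =
     2 * (x - of_nat (length xs)) * \<psi> ((u @ [?b]) @ ?Y @ w)
     + (\<Sum>q\<in>set xs. \<Sum>r\<in>set xs - {q}. pair_term (u @ [?b]) w xs s q r)"
    by (rule Cons.IH[OF dist])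
  show ?case
  proof -
    have "2 * t = 2 * (x - (1 + m)) * y + (2 * S + R)"
      if "t = t' + c" "c = - y + S" "2 * t' = 2 * (x - m) * y + R" for t t' c y S R m :: complex
      unfolding that(1,2) distrib_left that(3) by (simp add: algebra_simps)
    from this[OF A[unfolded append_assoc append.simps] C E[unfolded append_assoc append.simps]] show ?thesis
      unfolding D by simp
  qed
qed

end

section \<open>State sums over chord diagrams\<close>

text \<open>The set \<open>V\<close> of points is kept apart from the chords because the surgeries change the chords only.\<close>

definition constant_on_chords :: "nat set set \<Rightarrow> nat set \<Rightarrow> (nat \<Rightarrow> axis) \<Rightarrow> bool" where
  "constant_on_chords D V s \<longleftrightarrow> s \<in> extensional V \<and> (\<forall>c\<in>D. \<forall>p\<in>c. \<forall>q\<in>c. s p = s q)"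

definition labellings :: "nat set set \<Rightarrow> (nat \<Rightarrow> axis) set" where
  "labellings D = Collect (constant_on_chords D (\<Union>D))"

lemma finite_labellings:
  assumes "finite (\<Union>D)" shows "finite (labellings D)"
proof (rule finite_subset)
  show "labellings D \<subseteq> PiE (\<Union>D) (\<lambda>_. UNIV)"
    unfolding labellings_def constant_on_chords_def PiE_def by auto
  show "finite (PiE (\<Union>D) (\<lambda>_. UNIV :: axis set))" using assms by (rule finite_PiE) simp
qed

lemma labellingsD: "s \<in> labellings D \<Longrightarrow> c \<in> D \<Longrightarrow> p \<in> c \<Longrightarrow> q \<in> c \<Longrightarrow> s p = s q"
  unfolding labellings_def constant_on_chords_def by blast

lemma constant_on_chords_insert:
  "constant_on_chords (insert {p, q} D) V s \<longleftrightarrow> constant_on_chords D V s \<and> s p = s q"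
proof -
  have "(\<forall>c\<in>insert {p, q} D. P c) \<longleftrightarrow> P {p, q} \<and> (\<forall>c\<in>D. P c)" for P by blast
  moreover have "(\<forall>u\<in>{p, q}. \<forall>v\<in>{p, q}. s u = s v) \<longleftrightarrow> s p = s q" by auto
  ultimately show ?thesis unfolding constant_on_chords_def by (simp only: conj_ac)
qed

lemma constant_on_chords_upd:
  assumes "p \<in> V" "p \<notin> \<Union>D"
  shows "constant_on_chords D V (s(p := d)) \<longleftrightarrow> constant_on_chords D V s"
proof -
  have eq: "(s(p := d)) u = s u" if "u \<in> c" "c \<in> D" for u c using assms(2) that by auto
  have "(\<forall>c\<in>D. \<forall>u\<in>c. \<forall>v\<in>c. (s(p := d)) u = (s(p := d)) v) \<longleftrightarrow> (\<forall>c\<in>D. \<forall>u\<in>c. \<forall>v\<in>c. s u = s v)"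
    by (intro ball_cong refl) (metis eq)
  moreover have "s(p := d) \<in> extensional V \<longleftrightarrow> s \<in> extensional V"
    using assms(1) by (auto simp: extensional_def)
  ultimately show ?thesis unfolding constant_on_chords_def by (simp only:)
qed

lemma remove_two_chords:
  assumes "pairwise disjnt D" "{p, p'} \<in> D" "{q, q'} \<in> D"
  obtains R where "R = D - {{p, p'}, {q, q'}}" "D = insert {p, p'} (insert {q, q'} R)"
    "{p, p', q, q'} \<inter> \<Union>R = {}"
proof -
  define R where "R = D - {{p, p'}, {q, q'}}"
  have dj: "disjnt c {p, p'} \<and> disjnt c {q, q'}" if "c \<in> R" for c
    using assms that unfolding R_def pairwise_def by (metis Diff_iff insertI1 insertI2)
  have "{p, p', q, q'} \<inter> \<Union>R = {}"
    using dj by (fastforce simp: disjnt_def)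
  moreover have "D = insert {p, p'} (insert {q, q'} R)" using assms unfolding R_def by auto
  ultimately show ?thesis using that[OF R_def] by blast
qed

text \<open>Summing over the common label of \<open>p\<close> and \<open>q\<close> separates them from their partners, which
  are then only forced to agree with each other.\<close>

lemma sum_labellings_reconnect:
  assumes "pairwise disjnt D" "{p, p'} \<in> D" "{q, q'} \<in> D" "distinct [p, p', q, q']"
    and fin: "finite (\<Union>D)"
  shows "(\<Sum>s\<in>labellings D. if s p = s q then \<Sum>d\<in>UNIV. f (s(p := d, q := d)) else 0)
       = (\<Sum>s\<in>labellings (insert {p, q} (insert {p', q'} (D - {{p, p'}, {q, q'}}))). f s :: complex)"
proof -
  obtain R where R: "R = D - {{p, p'}, {q, q'}}" "D = insert {p, p'} (insert {q, q'} R)"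
    and disj: "{p, p', q, q'} \<inter> \<Union>R = {}"
    by (rule remove_two_chords[OF assms(1-3)])
  define V where "V = \<Union>R \<union> {p, p', q, q'}"
  define E where "E = constant_on_chords R V"
  have "\<Union>D = V" "\<Union>(insert {p, q} (insert {p', q'} R)) = V" unfolding R(2) V_def by auto
  then have E: "s \<in> labellings D \<longleftrightarrow> E s \<and> s q = s q' \<and> s p = s p'"
    "s \<in> labellings (insert {p, q} (insert {p', q'} R)) \<longleftrightarrow> E s \<and> s p' = s q' \<and> s p = s q" for s
    unfolding labellings_def mem_Collect_eq E_def
    by (simp_all only: R(2) constant_on_chords_insert conj_assoc)
  have upd: "E (s(p := d, q := d')) = E s" for s d d'
    unfolding E_def using disj by (simp add: constant_on_chords_upd V_def)
  let ?A = "{s \<in> labellings D. s p = s q}"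
  let ?i = "\<lambda>t. (t(p := t p', q := t p'), t p)" and ?j = "\<lambda>(s, d). s(p := d, q := d)"
  have pq: "p \<noteq> p'" "p \<noteq> q" "p \<noteq> q'" "p' \<noteq> q" "p' \<noteq> q'" "q \<noteq> q'" using assms(4) by auto
  have "(\<Sum>s\<in>labellings D. if s p = s q then \<Sum>d\<in>UNIV. f (s(p := d, q := d)) else 0)
     = (\<Sum>s\<in>?A. \<Sum>d\<in>UNIV. f (s(p := d, q := d)))"
    by (rule sum.inter_filter[symmetric]) (rule finite_labellings[OF fin])
  also have "\<dots> = (\<Sum>(s, d)\<in>?A \<times> UNIV. f (s(p := d, q := d)))"
    by (rule sum.cartesian_product)
  also have "\<dots> = (\<Sum>t\<in>labellings (insert {p, q} (insert {p', q'} R)). f t)"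
  proof (rule sum.reindex_bij_witness[where i = ?i and j = ?j])
    fix a assume "a \<in> ?A \<times> (UNIV :: axis set)"
    then obtain s d where a: "a = (s, d)" "E s" "s p = s p'" "s q = s p'" "s q' = s p'"
      using E(1) by (cases a) auto
    show "?i (?j a) = a" using a pq by (auto simp: fun_eq_iff)
    show "?j a \<in> labellings (insert {p, q} (insert {p', q'} R))"
      using a pq by (simp add: E upd)
    show "f (?j a) = (case a of (s, d) \<Rightarrow> f (s(p := d, q := d)))" by (simp add: a)
  next
    fix t assume "t \<in> labellings (insert {p, q} (insert {p', q'} R))"
    then have t: "E t" "t q = t p" "t q' = t p'" using E(2) by auto
    show "?j (?i t) = t" using t pq by (auto simp: fun_eq_iff)
    show "?i t \<in> ?A \<times> UNIV" using t pq by (simp add: E upd)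
  qed
  finally show ?thesis unfolding R(1) .
qed

lemma sum_labellings_swap:
  assumes "pairwise disjnt D" "{p, p'} \<in> D" "{q, q'} \<in> D" "distinct [p, p', q, q']"
  shows "(\<Sum>s\<in>labellings D. f (s(p := s q, q := s p)))
       = (\<Sum>s\<in>labellings (insert {p, q'} (insert {q, p'} (D - {{p, p'}, {q, q'}}))). f s)"
proof -
  obtain R where R: "R = D - {{p, p'}, {q, q'}}" "D = insert {p, p'} (insert {q, q'} R)"
    and disj: "{p, p', q, q'} \<inter> \<Union>R = {}"
    by (rule remove_two_chords[OF assms(1-3)])
  define V where "V = \<Union>R \<union> {p, p', q, q'}"
  define E where "E = constant_on_chords R V"
  have "\<Union>D = V" "\<Union>(insert {p, q'} (insert {q, p'} R)) = V" unfolding R(2) V_def by auto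
  then have E: "s \<in> labellings D \<longleftrightarrow> E s \<and> s q = s q' \<and> s p = s p'"
    "s \<in> labellings (insert {p, q'} (insert {q, p'} R)) \<longleftrightarrow> E s \<and> s q = s p' \<and> s p = s q'" for s
    unfolding labellings_def mem_Collect_eq E_def
    by (simp_all only: R(2) constant_on_chords_insert conj_assoc)
  have upd: "E (s(p := d, q := d')) = E s" for s d d'
    unfolding E_def using disj by (simp add: constant_on_chords_upd V_def)
  have pq: "p \<noteq> p'" "p \<noteq> q" "p \<noteq> q'" "p' \<noteq> q" "p' \<noteq> q'" "q \<noteq> q'" using assms(4) by auto
  let ?sw = "\<lambda>s. s(p := s q, q := s p)"
  have sw: "?sw (?sw s) = s" for s :: "nat \<Rightarrow> axis" using pq by (auto simp: fun_eq_iff)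
  have "(\<Sum>s\<in>labellings D. f (?sw s)) = (\<Sum>s\<in>labellings (insert {p, q'} (insert {q, p'} R)). f s)"
  proof (rule sum.reindex_bij_witness[where i = ?sw and j = ?sw])
    show "?sw s \<in> labellings (insert {p, q'} (insert {q, p'} R))" if "s \<in> labellings D" for s
      using that pq by (simp add: E upd)
    show "?sw s \<in> labellings D" if "s \<in> labellings (insert {p, q'} (insert {q, p'} R))" for s
      using that pq by (simp add: E upd)
  qed (rule sw sw refl)+
  then show ?thesis unfolding R(1) .
qed

lemma sum_labellings_remove_chord:
  assumes "pairwise disjnt D" "{p, q} \<in> D" "p \<noteq> q"
  shows "(\<Sum>s\<in>labellings D. f s) = (\<Sum>s\<in>labellings (D - {{p, q}}). \<Sum>d\<in>UNIV. f (s(p := d, q := d)))"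
proof -
  obtain R where "R = D - {{p, q}, {p, q}}" "D = insert {p, q} (insert {p, q} R)"
    and disj: "{p, q, p, q} \<inter> \<Union>R = {}"
    by (rule remove_two_chords[OF assms(1,2,2)])
  then have R: "R = D - {{p, q}}" "D = insert {p, q} R" by auto
  define V where "V = \<Union>R \<union> {p, q}"
  define E where "E = constant_on_chords R V"
  have V: "\<Union>D = V" unfolding R(2) V_def by auto
  have E1: "s \<in> labellings D \<longleftrightarrow> E s \<and> s p = s q" for s
    unfolding labellings_def mem_Collect_eq V E_def by (simp only: R(2) constant_on_chords_insert)
  have E2: "s \<in> labellings R \<longleftrightarrow> E s \<and> s p = undefined \<and> s q = undefined" for s
  proof -
    have "s \<in> extensional (\<Union>R) \<longleftrightarrow> s \<in> extensional V \<and> s p = undefined \<and> s q = undefined"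
      using disj unfolding extensional_def V_def by auto
    then show ?thesis
      unfolding labellings_def mem_Collect_eq E_def constant_on_chords_def by (simp only: conj_ac)
  qed
  have upd: "E (s(p := d, q := d')) = E s" for s d d'
    unfolding E_def using disj by (simp add: constant_on_chords_upd V_def)
  let ?i = "\<lambda>t. (t(p := undefined, q := undefined), t p)" and ?j = "\<lambda>(s, d). s(p := d, q := d)"
  have "(\<Sum>s\<in>labellings R. \<Sum>d\<in>UNIV. f (s(p := d, q := d)))
      = (\<Sum>(s, d)\<in>labellings R \<times> UNIV. f (s(p := d, q := d)))"
    by (rule sum.cartesian_product)
  also have "\<dots> = (\<Sum>s\<in>labellings D. f s)"
  proof (rule sum.reindex_bij_witness[where i = ?i and j = ?j])
    fix a assume "a \<in> labellings R \<times> (UNIV :: axis set)"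
    then obtain s d where a: "a = (s, d)" "E s" "s p = undefined" "s q = undefined"
      using E2 by (cases a) auto
    show "?i (?j a) = a" using a assms(3) by (auto simp: fun_eq_iff)
    show "?j a \<in> labellings D" using a assms(3) by (simp add: E1 upd)
    show "f (?j a) = (case a of (s, d) \<Rightarrow> f (s(p := d, q := d)))" by (simp add: a)
  next
    fix t assume "t \<in> labellings D"
    then have t: "E t" "t q = t p" using E1 by auto
    show "?j (?i t) = t" using t assms(3) by (auto simp: fun_eq_iff)
    show "?i t \<in> labellings R \<times> UNIV" using t assms(3) by (simp add: E2 upd)
  qed
  finally show ?thesis unfolding R(1) by (rule sym)
qed

text \<open>Joining the two ends of a single chord creates a closed loop, of value 3.\<close>

lemma sum_labellings_same:
  assumes "pairwise disjnt D" "{p, q} \<in> D" "p \<noteq> q"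
  shows "(\<Sum>s\<in>labellings D. if s p = s q then \<Sum>d\<in>UNIV. f (s(p := d, q := d)) else 0)
       = (3 :: complex) * (\<Sum>s\<in>labellings D. f s)"
proof -
  let ?g = "\<lambda>s. \<Sum>d\<in>UNIV. f (s(p := d, q := d))"
  have upd: "s(p := e, q := e, p := d, q := d) = s(p := d, q := d)" for s :: "nat \<Rightarrow> axis" and d e
    by (auto simp: fun_eq_iff)
  have "(\<Sum>s\<in>labellings D. if s p = s q then ?g s else 0) = (\<Sum>s\<in>labellings D. ?g s)"
    using labellingsD[OF _ assms(2), of _ p q] by (intro sum.cong refl) auto
  also have "\<dots> = (\<Sum>s\<in>labellings (D - {{p, q}}). \<Sum>d\<in>(UNIV :: axis set). ?g s)"
    by (simp only: sum_labellings_remove_chord[OF assms, of ?g] upd)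
  also have "\<dots> = 3 * (\<Sum>s\<in>labellings (D - {{p, q}}). ?g s)"
    by (simp only: sum_axis sum_distrib_left) (simp add: algebra_simps)
  finally show ?thesis unfolding sum_labellings_remove_chord[OF assms, of f] .
qed

lemma sum_labellings_swap_same:
  assumes "{p, q} \<in> D"
  shows "(\<Sum>s\<in>labellings D. f (s(p := s q, q := s p))) = (\<Sum>s\<in>labellings D. f s)"
proof (rule sum.cong)
  fix s assume "s \<in> labellings D"
  then have "s p = s q" using assms by (rule labellingsD) auto
  then have "s(p := s q, q := s p) = s" by (auto simp: fun_eq_iff)
  then show "f (s(p := s q, q := s p)) = f s" by (simp only:)
qed simp

section \<open>The recursion for state sums\<close>

lemma sum_over_chords:
  assumes "finite D" "\<And>c. c \<in> D \<Longrightarrow> card c = 2" "pairwise disjnt D" "B \<subseteq> \<Union>D"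
  shows "(\<Sum>p\<in>B. f p) = (\<Sum>c\<in>D. \<Sum>p\<in>c \<inter> B. f p)"
proof -
  have "B = (\<Union>c\<in>D. c \<inter> B)" using assms(4) by auto
  also have "(\<Sum>p\<in>\<dots>. f p) = (\<Sum>c\<in>D. \<Sum>p\<in>c \<inter> B. f p)"
  proof (rule sum.UNION_disjoint)
    show "\<forall>c\<in>D. finite (c \<inter> B)" using assms(2) by (metis card.infinite finite_Int zero_neq_numeral)
    show "\<forall>c\<in>D. \<forall>d\<in>D. c \<noteq> d \<longrightarrow> c \<inter> B \<inter> (d \<inter> B) = {}"
      using assms(3) unfolding pairwise_def disjnt_def by blast
  qed (use assms in auto)
  finally show ?thesis .
qed

text \<open>Regrouping a sum over pairs of points by chords. A chord with both ends in \<open>B\<close> cancels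
  against every other chord, and with itself it contributes \<open>2 * y\<close> for each of its two ends, which
  are the points counted by \<open>card B - card I\<close>. What remains are the chords with exactly one end in \<open>B\<close>.\<close>

lemma sum_pairs_of_points:
  fixes t :: "nat \<Rightarrow> nat \<Rightarrow> complex"
  assumes D: "finite D" "\<And>c. c \<in> D \<Longrightarrow> card c = 2" "pairwise disjnt D" and B: "B \<subseteq> \<Union>D"
    and same: "\<And>p q. {p, q} \<in> D \<Longrightarrow> p \<noteq> q \<Longrightarrow> p \<in> B \<Longrightarrow> q \<in> B \<Longrightarrow> t p q = 2 * y"
    and cancel: "\<And>p p' c q. {p, p'} \<in> D \<Longrightarrow> p \<noteq> p' \<Longrightarrow> c \<in> D \<Longrightarrow> c \<noteq> {p, p'} \<Longrightarrow>
        p \<in> B \<Longrightarrow> p' \<in> B \<Longrightarrow> q \<in> c \<inter> B \<Longrightarrow> t p q + t p' q = 0 \<and> t q p + t q p' = 0"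
    and I: "I = {c \<in> D. card (c \<inter> B) = 1}"
    and e: "\<And>c. c \<in> I \<Longrightarrow> e c \<in> c \<inter> B"
  shows "(\<Sum>p\<in>B. \<Sum>q\<in>B - {p}. t p q)
     = 2 * (of_nat (card B) - of_nat (card I)) * y + (\<Sum>c\<in>I. \<Sum>d\<in>I - {c}. t (e c) (e d))"
proof -
  have over_chords: "(\<Sum>p\<in>B'. f p) = (\<Sum>c\<in>D. \<Sum>p\<in>c \<inter> B'. f p)" if "B' \<subseteq> \<Union>D"
    for f :: "nat \<Rightarrow> complex" and B'
    by (rule sum_over_chords[OF D(1) _ D(3) that]) (rule D(2))
  have fin: "finite c" if "c \<in> D" for c using D(2)[OF that] by (simp add: card_ge_0_finite)
  have eI: "c \<inter> B = {e c}" if "c \<in> I" for c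
  proof -
    have "card (c \<inter> B) = 1" using that I by simp
    then obtain z where "c \<inter> B = {z}" by (rule card_1_singletonE)
    then show ?thesis using e[OF that] by simp
  qed
  have IN: "\<exists>p q. c = {p, q} \<and> p \<noteq> q \<and> p \<in> B \<and> q \<in> B" if "c \<in> D" "c \<notin> I" "c \<inter> B \<noteq> {}" for c
  proof -
    have "card (c \<inter> B) \<noteq> 0" "card (c \<inter> B) \<noteq> 1" using that I fin[OF that(1)] by auto
    moreover have "card (c \<inter> B) \<le> card c" using fin[OF that(1)] by (intro card_mono) auto
    ultimately have "card (c \<inter> B) = card c" using D(2)[OF that(1)] by simp
    then have "c \<inter> B = c" using fin[OF that(1)] by (intro card_subset_eq) auto
    moreover from D(2)[OF that(1)] obtain p q where "c = {p, q}" "p \<noteq> q" by (auto simp: card_2_iff)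
    ultimately show ?thesis by auto
  qed
  have [simp]: "finite I" using I D(1) by simp
  have ID: "I \<subseteq> D" using I by auto
  have diag: "(\<Sum>p\<in>c \<inter> B. \<Sum>q\<in>c \<inter> B - {p}. t p q) = 2 * (of_nat (card (c \<inter> B)) - (if c \<in> I then 1 else 0)) * y"
    if "c \<in> D" for c
  proof (cases "c \<in> I")
    case True
    then show ?thesis by (simp add: eI)
  next
    case False
    show ?thesis
    proof (cases "c \<inter> B = {}")
      case False
      from IN[OF that \<open>c \<notin> I\<close> False] obtain p q where pq: "c = {p, q}" "p \<noteq> q" "p \<in> B" "q \<in> B" by auto
      then have "c \<inter> B = {p, q}" "{p, q} - {p} = {q}" "{p, q} - {q} = {p}" by auto
      moreover have "t p q = 2 * y" "t q p = 2 * y"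
        using same[of p q] same[of q p] that pq by (auto simp: insert_commute)
      ultimately show ?thesis using \<open>c \<notin> I\<close> pq by simp
    qed (use \<open>c \<notin> I\<close> in simp)
  qed
  have off: "(\<Sum>p\<in>c \<inter> B. \<Sum>q\<in>d \<inter> B. t p q) = (if c \<in> I \<and> d \<in> I then t (e c) (e d) else 0)"
    if cd: "c \<in> D" "d \<in> D" "c \<noteq> d" for c d
  proof -
    consider "c \<in> I" "d \<in> I" | "c \<notin> I" | "d \<notin> I" by blast
    then show ?thesis
    proof cases
      case 1
      then show ?thesis by (simp add: eI)
    next
      case 2
      show ?thesis
      proof (cases "c \<inter> B = {}")
        case False
        from IN[OF cd(1) 2 False] obtain p p' where pq: "c = {p, p'}" "p \<noteq> p'" "p \<in> B" "p' \<in> B" by auto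
        then have "c \<inter> B = {p, p'}" by auto
        then have "(\<Sum>p\<in>c \<inter> B. \<Sum>q\<in>d \<inter> B. t p q) = (\<Sum>q\<in>d \<inter> B. t p q + t p' q)"
          using pq by (simp add: sum.distrib)
        also have "\<dots> = 0" using cancel[of p p' d] cd pq by (intro sum.neutral) auto
        finally show ?thesis using 2 by simp
      qed (use 2 in simp)
    next
      case 3
      show ?thesis
      proof (cases "d \<inter> B = {}")
        case False
        from IN[OF cd(2) 3 False] obtain p p' where pq: "d = {p, p'}" "p \<noteq> p'" "p \<in> B" "p' \<in> B" by auto
        then have "d \<inter> B = {p, p'}" by auto
        then have "(\<Sum>p\<in>c \<inter> B. \<Sum>q\<in>d \<inter> B. t p q) = (\<Sum>q\<in>c \<inter> B. t q p + t q p')"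
          using pq by simp
        also have "\<dots> = 0" using cancel[of p p' c] cd pq by (intro sum.neutral) auto
        finally show ?thesis using 3 by simp
      qed (use 3 in simp)
    qed
  qed
  have "(\<Sum>p\<in>B. \<Sum>q\<in>B - {p}. t p q) = (\<Sum>c\<in>D. \<Sum>p\<in>c \<inter> B. \<Sum>q\<in>B - {p}. t p q)"
    by (rule over_chords[OF B])
  also have "\<dots> = (\<Sum>c\<in>D. (\<Sum>p\<in>c \<inter> B. \<Sum>q\<in>c \<inter> B - {p}. t p q)
      + (\<Sum>d\<in>D - {c}. \<Sum>p\<in>c \<inter> B. \<Sum>q\<in>d \<inter> B. t p q))"
  proof (rule sum.cong[OF refl])
    fix c assume c: "c \<in> D"
    have "(\<Sum>q\<in>B - {p}. t p q) = (\<Sum>q\<in>c \<inter> B - {p}. t p q) + (\<Sum>d\<in>D - {c}. \<Sum>q\<in>d \<inter> B. t p q)"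
      if p: "p \<in> c \<inter> B" for p
    proof -
      have "(\<Sum>q\<in>B - {p}. t p q) = (\<Sum>d\<in>D. \<Sum>q\<in>d \<inter> (B - {p}). t p q)"
        by (rule over_chords) (use B in auto)
      also have "\<dots> = (\<Sum>q\<in>c \<inter> (B - {p}). t p q) + (\<Sum>d\<in>D - {c}. \<Sum>q\<in>d \<inter> (B - {p}). t p q)"
        by (rule sum.remove[OF D(1) c])
      also have "c \<inter> (B - {p}) = c \<inter> B - {p}" by auto
      also have "(\<Sum>d\<in>D - {c}. \<Sum>q\<in>d \<inter> (B - {p}). t p q) = (\<Sum>d\<in>D - {c}. \<Sum>q\<in>d \<inter> B. t p q)"
      proof (rule sum.cong[OF refl])
        fix d assume "d \<in> D - {c}"
        then have "p \<notin> d" using D(3) c p unfolding pairwise_def disjnt_def by blast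
        then have "d \<inter> (B - {p}) = d \<inter> B" by auto
        then show "(\<Sum>q\<in>d \<inter> (B - {p}). t p q) = (\<Sum>q\<in>d \<inter> B. t p q)" by simp
      qed
      finally show ?thesis .
    qed
    then have "(\<Sum>p\<in>c \<inter> B. \<Sum>q\<in>B - {p}. t p q) = (\<Sum>p\<in>c \<inter> B. (\<Sum>q\<in>c \<inter> B - {p}. t p q)
        + (\<Sum>d\<in>D - {c}. \<Sum>q\<in>d \<inter> B. t p q))" by (rule sum.cong[OF refl])
    also have "\<dots> = (\<Sum>p\<in>c \<inter> B. \<Sum>q\<in>c \<inter> B - {p}. t p q)
        + (\<Sum>d\<in>D - {c}. \<Sum>p\<in>c \<inter> B. \<Sum>q\<in>d \<inter> B. t p q)"
      unfolding sum.distrib by (subst (2) sum.swap) (rule refl)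
    finally show "(\<Sum>p\<in>c \<inter> B. \<Sum>q\<in>B - {p}. t p q) = \<dots>" .
  qed
  also have "\<dots> = (\<Sum>c\<in>D. 2 * (of_nat (card (c \<inter> B)) - (if c \<in> I then 1 else 0)) * y)
      + (\<Sum>c\<in>D. \<Sum>d\<in>D - {c}. if c \<in> I \<and> d \<in> I then t (e c) (e d) else 0)"
    unfolding sum.distrib
    by (intro arg_cong2[where f = "(+)"] sum.cong refl diag off) auto
  also have "(\<Sum>c\<in>D. 2 * (of_nat (card (c \<inter> B)) - (if c \<in> I then 1 else 0)) * y)
      = 2 * (of_nat (card B) - of_nat (card I)) * y"
  proof -
    have "(\<Sum>c\<in>D. if c \<in> I then 1 else 0 :: complex) = of_nat (card I)"
      using D(1) ID by (simp add: Int_absorb1 flip: sum.inter_restrict)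
    moreover have "of_nat (card B) = (\<Sum>c\<in>D. of_nat (card (c \<inter> B)) :: complex)"
      using over_chords[OF B, of "\<lambda>_. 1 :: complex"] by simp
    ultimately show ?thesis
      by (simp only: sum_subtractf flip: sum_distrib_left sum_distrib_right)
  qed
  also have "(\<Sum>c\<in>D. \<Sum>d\<in>D - {c}. if c \<in> I \<and> d \<in> I then t (e c) (e d) else 0)
      = (\<Sum>c\<in>I. \<Sum>d\<in>I - {c}. t (e c) (e d))"
  proof -
    have "(\<Sum>c\<in>D. \<Sum>d\<in>D - {c}. if c \<in> I \<and> d \<in> I then t (e c) (e d) else 0)
       = (\<Sum>c\<in>D. if c \<in> I then \<Sum>d\<in>D - {c}. if d \<in> I then t (e c) (e d) else 0 else 0)"
      by (intro sum.cong refl) auto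
    also have "\<dots> = (\<Sum>c\<in>D \<inter> I. \<Sum>d\<in>D - {c}. if d \<in> I then t (e c) (e d) else 0)"
      using D(1) by (simp add: sum.inter_restrict)
    also have "\<dots> = (\<Sum>c\<in>D \<inter> I. \<Sum>d\<in>(D - {c}) \<inter> I. t (e c) (e d))"
      using D(1) by (simp add: sum.inter_restrict)
    also have "\<dots> = (\<Sum>c\<in>I. \<Sum>d\<in>I - {c}. t (e c) (e d))"
      using ID by (intro sum.cong) auto
    finally show ?thesis .
  qed
  finally show ?thesis .
qed

context so3_functional begin

definition diagram_sum where
  "diagram_sum D = (\<Sum>s\<in>labellings D. \<psi> (map s (sorted_list_of_set (\<Union>D))))"

text \<open>The defining recursion of the weight, for an arbitrary chord. Here \<open>contract_letters\<close> is applied to the points \<open>M\<close> strictly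
  between the ends of \<open>a\<close>, and \<open>sum_pairs_of_points\<close> removes the chords that do not cross \<open>a\<close>.\<close>

lemma diagram_sum_recursion:
  assumes D: "chord_diagram n D" and a: "a \<in> D"
  shows "2 * diagram_sum D =
     2 * (x - of_nat (card (crossing_chords D a))) * diagram_sum (D - {a})
     + (\<Sum>c\<in>crossing_chords D a. \<Sum>d\<in>crossing_chords D a - {c}.
          diagram_sum (surgery1 D a c d) - diagram_sum (surgery2 D a c d))"
proof -
  have fin: "finite D" and two: "\<And>c. c \<in> D \<Longrightarrow> card c = 2" and disj: "pairwise disjnt D"
    using D by (auto simp: chord_diagram_def)
  obtain A B where AB: "a = {A, B}" "A < B"
    using two[OF a] by (metis card_2_iff doubleton_eq_iff linorder_less_linear)
  have minmax: "Min a = A" "Max a = B" using AB by auto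
  define D' where "D' = D - {a}"
  define V where "V = \<Union>D'"
  have finD': "finite D'" and two': "\<And>c. c \<in> D' \<Longrightarrow> card c = 2" and disj': "pairwise disjnt D'"
    using fin two disj by (auto simp: D'_def intro: pairwise_subset)
  have "finite c" if "c \<in> D'" for c using two'[OF that] by (simp add: card_ge_0_finite)
  then have finV: "finite V" unfolding V_def using finD' by blast
  have VD: "\<Union>D = insert A (insert B V)" unfolding V_def D'_def using a AB by auto
  have AV: "A \<notin> V" "B \<notin> V"
  proof -
    have "A \<notin> c \<and> B \<notin> c" if "c \<in> D'" for c
    proof -
      have "disjnt c a" using disj a that unfolding D'_def pairwise_def by blast
      then show ?thesis unfolding AB(1) by (auto simp: disjnt_def)
    qed
    then show "A \<notin> V" "B \<notin> V" unfolding V_def by auto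
  qed
  define M where "M = {q \<in> V. between a q}"
  define u where "u = sorted_list_of_set {q \<in> V. q < A}"
  define v where "v = sorted_list_of_set M"
  define w where "w = sorted_list_of_set {q \<in> V. B < q}"
  have M: "M = {q \<in> V. A < q \<and> q < B}" unfolding M_def between_def minmax ..
  have [simp]: "set u = {q \<in> V. q < A}" "set v = M" "set w = {q \<in> V. B < q}"
    "sorted u" "sorted v" "sorted w" "distinct u" "distinct v" "distinct w"
    using finV by (simp_all add: u_def v_def w_def M_def)
  \<comment> \<open>Cutting the circle at the base point, the points of \<open>D'\<close> form three blocks \<open>u\<close>, \<open>v\<close>, \<open>w\<close> separated by \<open>A\<close> and \<open>B\<close>.\<close>
  have trich: "q < A \<or> A < q \<and> q < B \<or> B < q" if "q \<in> V" for q
    using that AV by (metis linorder_less_linear)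
  have sortD': "sorted_list_of_set V = u @ v @ w"
  proof (rule sym, rule sorted_distinct_set_unique)
    show "sorted (u @ v @ w)" using AB(2) by (auto simp: sorted_append M)
    show "distinct (u @ v @ w)" using AB(2) by (auto simp: M)
    show "set (u @ v @ w) = set (sorted_list_of_set V)" using finV trich by (auto simp: M)
  qed (use finV in auto)
  have sortD: "sorted_list_of_set (\<Union>D) = u @ A # v @ B # w"
  proof (rule sym, rule sorted_distinct_set_unique)
    show "sorted (u @ A # v @ B # w)" using AB(2) by (auto simp: sorted_append M)
    show "distinct (u @ A # v @ B # w)" using AB(2) AV by (auto simp: M)
    show "set (u @ A # v @ B # w) = set (sorted_list_of_set (\<Union>D))"
    proof -
      have "set (sorted_list_of_set (insert A (insert B V))) = insert A (insert B V)"
        by (rule set_sorted_list_of_set) (simp add: finV)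
      then show ?thesis unfolding VD using trich by (auto simp: M)
    qed
  qed (use finV in auto)
  define f where "f s = \<psi> (map s (u @ v @ w))" for s
  have ds: "diagram_sum E = (\<Sum>s\<in>labellings E. f s)" if "\<Union>E = V" for E
    unfolding diagram_sum_def that sortD' f_def ..
  define t where "t p q = (\<Sum>s\<in>labellings D'. pair_term (map s u) (map s w) v s p q)" for p q
  define y where "y = diagram_sum D'"
  have y: "y = (\<Sum>s\<in>labellings D'. f s)" unfolding y_def by (rule ds) (simp add: V_def)
  have t: "t p q = (\<Sum>s\<in>labellings D'. if s p = s q then \<Sum>d\<in>UNIV. f (s(p := d, q := d)) else 0)
      - (\<Sum>s\<in>labellings D'. f (s(p := s q, q := s p)))" if pq: "p \<in> M" "q \<in> M" for p q
  proof -
    have upd: "map (s(p := d, q := d')) u = map s u" "map (s(p := d, q := d')) w = map s w" for d d' s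
      using pq by (auto simp: M)
    show ?thesis
      unfolding t_def pair_term_def sum_subtractf f_def map_append upd ..
  qed
  have expand: "2 * diagram_sum D
     = 2 * (x - of_nat (card M)) * y + (\<Sum>p\<in>M. \<Sum>q\<in>M - {p}. t p q)"
  proof -
    have "2 * diagram_sum D = 2 * (\<Sum>s\<in>labellings D'. \<Sum>d\<in>UNIV.
         \<psi> (map (s(A := d, B := d)) (u @ A # v @ B # w)))"
      unfolding diagram_sum_def sortD D'_def AB(1)
      by (subst sum_labellings_remove_chord[OF disj]) (use a AB in auto)
    also have "\<dots> = (\<Sum>s\<in>labellings D'. 2 * (\<Sum>d\<in>UNIV. \<psi> (map s u @ d # map s v @ d # map s w)))"
    proof -
      have upd: "map (s(A := d, B := d)) u = map s u" "map (s(A := d, B := d)) v = map s v"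
        "map (s(A := d, B := d)) w = map s w" for s :: "nat \<Rightarrow> axis" and d
        using AV by (auto simp: M)
      have "map (s(A := d, B := d)) (u @ A # v @ B # w) = map s u @ d # map s v @ d # map s w"
        for s :: "nat \<Rightarrow> axis" and d
        unfolding map_append list.map upd using AB(2) by simp
      then show ?thesis by (simp only: sum_distrib_left)
    qed
    also have "\<dots> = (\<Sum>s\<in>labellings D'. 2 * (x - of_nat (card M)) * f s
        + (\<Sum>p\<in>M. \<Sum>q\<in>M - {p}. pair_term (map s u) (map s w) v s p q))"
    proof -
      have "length v = card M" by (metis \<open>distinct v\<close> \<open>set v = M\<close> distinct_card)
      then show ?thesis
        by (subst contract_letters) (simp_all add: f_def)
    qed
    also have "\<dots> = 2 * (x - of_nat (card M)) * y
        + (\<Sum>s\<in>labellings D'. \<Sum>p\<in>M. \<Sum>q\<in>M - {p}. pair_term (map s u) (map s w) v s p q)"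
      unfolding y by (simp add: sum.distrib sum_distrib_left)
    also have "(\<Sum>s\<in>labellings D'. \<Sum>p\<in>M. \<Sum>q\<in>M - {p}. pair_term (map s u) (map s w) v s p q)
        = (\<Sum>p\<in>M. \<Sum>q\<in>M - {p}. t p q)"
      unfolding t_def by (subst sum.swap, subst (2) sum.swap) (rule refl)
    finally show ?thesis .
  qed
  have same: "t p q = 2 * y" if "{p, q} \<in> D'" "p \<noteq> q" "p \<in> M" "q \<in> M" for p q
    unfolding t[OF that(3,4)] sum_labellings_same[OF disj' that(1,2)] sum_labellings_swap_same[OF that(1)] y
    by simp
  have diff: "t p q = diagram_sum (insert {p, q} (insert {p', q'} (D' - {{p, p'}, {q, q'}})))
      - diagram_sum (insert {p, q'} (insert {q, p'} (D' - {{p, p'}, {q, q'}})))"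
    if "{p, p'} \<in> D'" "{q, q'} \<in> D'" "distinct [p, p', q, q']" "p \<in> M" "q \<in> M" for p p' q q'
  proof -
    from remove_two_chords[OF disj' that(1,2)] obtain R
      where R: "R = D' - {{p, p'}, {q, q'}}" "D' = insert {p, p'} (insert {q, q'} R)" by metis
    have "\<Union>(insert {p, q} (insert {p', q'} R)) = V" "\<Union>(insert {p, q'} (insert {q, p'} R)) = V"
      unfolding V_def R(2) by auto
    note ds = this[THEN ds]
    show ?thesis
      unfolding t[OF that(4,5)] sum_labellings_swap[OF disj' that(1-3)]
        sum_labellings_reconnect[OF disj' that(1-3) finV[unfolded V_def]]
      unfolding R(1)[symmetric] ds ..
  qed
  have chord_cases: "\<exists>q'. c = {q, q'} \<and> q \<noteq> q'" if "c \<in> D'" "q \<in> c" for c q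
    using two'[OF that(1)] that(2) by (auto simp: card_2_iff)
  have dist: "distinct [p, p', q, q']" if "{p, p'} \<in> D'" "{q, q'} \<in> D'" "p \<noteq> p'" "q \<noteq> q'"
      "{p, p'} \<noteq> {q, q'}" for p p' q q'
  proof -
    have "disjnt {p, p'} {q, q'}" by (rule pairwiseD[OF disj' that(1,2,5)])
    then show ?thesis using that by (auto simp: disjnt_def)
  qed
  \<comment> \<open>Replacing \<open>p\<close> by its partner exchanges the two surgeries.\<close>
  have cancel: "t p q + t p' q = 0 \<and> t q p + t q p' = 0"
    if "{p, p'} \<in> D'" "p \<noteq> p'" "c \<in> D'" "c \<noteq> {p, p'}" "p \<in> M" "p' \<in> M" "q \<in> c \<inter> M"
    for p p' c q
  proof -
    have "c \<in> D'" "q \<in> c" using that by auto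
    from chord_cases[OF this] obtain q' where c: "c = {q, q'}" "q \<noteq> q'" by blast
    have D1: "distinct [p, p', q, q']" and D2: "distinct [p', p, q, q']"
      and D3: "distinct [q, q', p, p']" and D4: "distinct [q, q', p', p]"
      using dist[of p p' q q'] that c by auto
    have p'p: "{p', p} \<in> D'" using that by (simp add: insert_commute)
    have qq: "{q, q'} \<in> D'" "q \<in> M" using that c by auto
    show ?thesis
      unfolding diff[OF that(1) qq(1) D1 that(5) qq(2)] diff[OF p'p qq(1) D2 that(6) qq(2)]
        diff[OF qq(1) that(1) D3 qq(2) that(5)] diff[OF qq(1) p'p D4 qq(2) that(6)]
      by (simp add: insert_commute)
  qed
  have MV: "M \<subseteq> \<Union>D'" unfolding M_def V_def by auto
  define I where "I = crossing_chords D a"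
  have chord: "c = {Min c, Max c}" "Min c \<noteq> Max c" if "c \<in> D'" for c
  proof -
    from two'[OF that] obtain p q where "c = {p, q}" "p < q"
      by (metis card_2_iff doubleton_eq_iff linorder_less_linear)
    then show "c = {Min c, Max c}" "Min c \<noteq> Max c" by auto
  qed
  have inM: "q \<in> M \<longleftrightarrow> between a q" if "c \<in> D'" "q \<in> c" for c q
    using that unfolding M_def V_def by auto
  have cross: "c \<in> I \<longleftrightarrow> card (c \<inter> M) = 1" if c: "c \<in> D'" for c
  proof -
    obtain p q where pq: "c = {p, q}" "p \<noteq> q" "Min c = p" "Max c = q" using chord[OF c] by blast
    have "c \<inter> M = (if between a p then {p} else {}) \<union> (if between a q then {q} else {})"
      using inM[OF c, of p] inM[OF c, of q] pq by auto
    then show ?thesis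
      using c pq unfolding I_def crossing_chords_def crosses_def D'_def by auto
  qed
  have I: "I = {c \<in> D'. card (c \<inter> M) = 1}"
    using cross unfolding I_def crossing_chords_def D'_def by blast
  have ID': "c \<in> D'" if "c \<in> I" for c using that I by simp
  have ends: "c = {endpt a c, endpt_star a c}" "endpt a c \<noteq> endpt_star a c" "endpt a c \<in> M"
    if "c \<in> I" for c
  proof -
    have "between a (Min c) \<noteq> between a (Max c)"
      using that unfolding I_def crossing_chords_def crosses_def by auto
    then have "between a (endpt a c)" unfolding endpt_def by auto
    moreover have "c = {endpt a c, endpt_star a c} \<and> endpt a c \<noteq> endpt_star a c"
      using chord[OF ID'[OF that]] unfolding endpt_def endpt_star_def by (auto simp: insert_commute)
    ultimately show "c = {endpt a c, endpt_star a c}" "endpt a c \<noteq> endpt_star a c" "endpt a c \<in> M"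
      using inM[OF ID'[OF that], of "endpt a c"] by auto
  qed
  have "(\<Sum>p\<in>M. \<Sum>q\<in>M - {p}. t p q)
     = 2 * (of_nat (card M) - of_nat (card I)) * y
       + (\<Sum>c\<in>I. \<Sum>d\<in>I - {c}. t (endpt a c) (endpt a d))"
    by (rule sum_pairs_of_points[OF finD' two' disj' MV same cancel I])
      (use ends in auto)
  also have "(\<Sum>c\<in>I. \<Sum>d\<in>I - {c}. t (endpt a c) (endpt a d))
     = (\<Sum>c\<in>I. \<Sum>d\<in>I - {c}. diagram_sum (surgery1 D a c d) - diagram_sum (surgery2 D a c d))"
  proof (intro sum.cong refl)
    fix c d assume c: "c \<in> I" and d: "d \<in> I - {c}"
    let ?p = "endpt a c" and ?p' = "endpt_star a c" and ?q = "endpt a d" and ?q' = "endpt_star a d"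
    have dI: "d \<in> I" using d by simp
    have chords: "{?p, ?p'} \<in> D'" "{?q, ?q'} \<in> D'" "distinct [?p, ?p', ?q, ?q']"
      using ends[OF c] ends[OF dI] ID'[OF c] ID'[OF dI] dist[of ?p ?p' ?q ?q'] d by auto
    have "D - {a, c, d} = D' - {{?p, ?p'}, {?q, ?q'}}"
      unfolding D'_def ends(1)[OF c, symmetric] ends(1)[OF dI, symmetric] by auto
    then show "t ?p ?q = diagram_sum (surgery1 D a c d) - diagram_sum (surgery2 D a c d)"
      unfolding surgery1_def surgery2_def
      by (simp add: diff[OF chords ends(3)[OF c] ends(3)[OF dI]])
  qed
  finally show ?thesis
    unfolding expand y_def D'_def I_def by (simp add: algebra_simps)
qed

end

section \<open>The weight as a state sum\<close>

lemma chord_diagram_surgery: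
  assumes D: "chord_diagram n D" and a: "a \<in> D"
    and cd: "c \<in> crossing_chords D a" "d \<in> crossing_chords D a" "c \<noteq> d"
  shows "chord_diagram (n - 1) (surgery1 D a c d)" "chord_diagram (n - 1) (surgery2 D a c d)"
proof -
  have fin: "finite D" and two: "\<And>c. c \<in> D \<Longrightarrow> card c = 2" and disj: "pairwise disjnt D"
    and card: "card D = n"
    using D by (auto simp: chord_diagram_def)
  have cD: "c \<in> D" "d \<in> D" "c \<noteq> a" "d \<noteq> a" using cd by (auto simp: crossing_chords_def)
  have ends: "e = {endpt a e, endpt_star a e} \<and> endpt a e \<noteq> endpt_star a e" if "e \<in> D" for e
  proof -
    from two[OF that] obtain p q where "e = {p, q}" "p < q"
      by (metis card_2_iff doubleton_eq_iff linorder_less_linear)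
    then have "e = {Min e, Max e}" "Min e \<noteq> Max e" by auto
    then show ?thesis unfolding endpt_def endpt_star_def by (auto simp: insert_commute)
  qed
  define p p' q q' where "p = endpt a c" "p' = endpt_star a c" "q = endpt a d" "q' = endpt_star a d"
  have c: "c = {p, p'}" "p \<noteq> p'" and d: "d = {q, q'}" "q \<noteq> q'"
    using ends[OF cD(1)] ends[OF cD(2)] unfolding p_p'_q_q'_def by auto
  have "disjnt c d" using pairwiseD[OF disj cD(1,2) cd(3)] .
  then have ne: "p \<noteq> q" "p \<noteq> q'" "p' \<noteq> q" "p' \<noteq> q'" unfolding c d by (auto simp: disjnt_def)
  define R where "R = D - {a, c, d}"
  have R: "\<And>e. e \<in> R \<Longrightarrow> card e = 2" "pairwise disjnt R" "finite R"
    using two fin disj unfolding R_def by (auto intro: pairwise_subset)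
  have "card {a, c, d} = 3" using cd(3) cD by auto
  then have cardR: "card R = n - 3" "n \<ge> 3"
    using card_Diff_subset[of "{a, c, d}" D] card_mono[of D "{a, c, d}"] cD a fin card
    unfolding R_def by auto
  have notin: "e \<inter> {p, p', q, q'} = {}" if "e \<in> R" for e
  proof -
    have "disjnt e c" "disjnt e d" using that pairwiseD[OF disj] cD unfolding R_def by auto
    then show ?thesis unfolding c d by (auto simp: disjnt_def)
  qed
  have build: "chord_diagram (n - 1) (R \<union> {{s, t}, {s', t'}})"
    if st: "{s, t, s', t'} = {p, p', q, q'}" "distinct [s, t, s', t']" for s t s' t'
  proof -
    have new: "disjnt e {s, t}" "disjnt e {s', t'}" if "e \<in> R" for e
      using notin[OF that] st(1) unfolding disjnt_def by blast+
    have st': "disjnt {s, t} {s', t'}" "{s, t} \<noteq> {s', t'}" "card {s, t} = 2" "card {s', t'} = 2"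
      using st(2) by (auto simp: disjnt_def)
    have "{s, t} \<notin> R" "{s', t'} \<notin> R" using new by (auto simp: disjnt_def)
    then have "card (R \<union> {{s, t}, {s', t'}}) = n - 1" using R(3) st' cardR by simp
    moreover have "pairwise disjnt (R \<union> {{s, t}, {s', t'}})"
      using R(2) new st'(1) by (auto simp: pairwise_insert disjnt_sym)
    ultimately show ?thesis
      using R(1,3) st' unfolding chord_diagram_def by auto
  qed
  show "chord_diagram (n - 1) (surgery1 D a c d)"
    unfolding surgery1_def R_def[symmetric] p_p'_q_q'_def[symmetric]
    by (rule build) (use ne c d in auto)
  show "chord_diagram (n - 1) (surgery2 D a c d)"
    unfolding surgery2_def R_def[symmetric] p_p'_q_q'_def[symmetric]
    by (rule build) (use ne c d in auto)
qed

lemma chord_diagram_remove: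
  "chord_diagram n D \<Longrightarrow> a \<in> D \<Longrightarrow> chord_diagram (n - 1) (D - {a})"
  unfolding chord_diagram_def by (auto intro: pairwise_subset)

lemma surgery_commute: "surgery1 D a c d = surgery1 D a d c" "surgery2 D a c d = surgery2 D a d c"
  unfolding surgery1_def surgery2_def by (auto simp: insert_commute)

lemma weight_value_exists: "chord_diagram n D \<Longrightarrow> n \<ge> 1 \<Longrightarrow> \<exists>p. weight_value D p"
proof (induction n arbitrary: D)
  case (Suc n)
  show ?case
  proof (cases "n = 0")
    case True
    then show ?thesis using weight_value.single Suc.prems by auto
  next
    case False
    have "card D \<noteq> 0" using Suc.prems unfolding chord_diagram_def by simp
    then obtain a where a: "a \<in> D" by (metis all_not_in_conv card.empty)
    have IH: "\<exists>p. weight_value E p" if "chord_diagram (Suc n - 1) E" for E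
      using Suc.IH that False by simp
    obtain p where p: "weight_value (D - {a}) p"
      using IH[OF chord_diagram_remove[OF Suc.prems(1) a]] by blast
    \<comment> \<open>The surgeries are symmetric in the two chords, so one value per two-element set can be chosen.\<close>
    define P where "P f S = (SOME q. \<exists>c d. S = {c, d} \<and> c \<in> crossing_chords D a \<and>
        d \<in> crossing_chords D a \<and> c \<noteq> d \<and> weight_value (f D a c d) q)" for f S
    have P: "weight_value (f D a c d) (P f {c, d})"
      if f: "\<And>c d. f D a c d = f D a d c" and ex: "\<exists>q. weight_value (f D a c d) q"
        and cd: "c \<in> crossing_chords D a" "d \<in> crossing_chords D a" "c \<noteq> d" for f c d
    proof -
      have "\<exists>q. \<exists>c' d'. {c, d} = {c', d'} \<and> c' \<in> crossing_chords D a \<and>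
        d' \<in> crossing_chords D a \<and> c' \<noteq> d' \<and> weight_value (f D a c' d') q"
        using ex cd by blast
      then have "\<exists>c' d'. {c, d} = {c', d'} \<and> c' \<in> crossing_chords D a \<and>
        d' \<in> crossing_chords D a \<and> c' \<noteq> d' \<and> weight_value (f D a c' d') (P f {c, d})"
        unfolding P_def by (rule someI_ex)
      then show ?thesis using f by (auto simp: doubleton_eq_iff)
    qed
    note surg = chord_diagram_surgery[OF Suc.prems(1) a]
    have "weight_value D (([:0, 1:] - of_nat (card (crossing_chords D a))) * p
       + (\<Sum>S | S \<subseteq> crossing_chords D a \<and> card S = 2. P surgery1 S - P surgery2 S))"
    proof (rule weight_value.step[OF Suc.prems(1) _ a p])
      show "Suc n \<ge> 2" using False by simp
      fix c d assume cd: "c \<in> crossing_chords D a" "d \<in> crossing_chords D a" "c \<noteq> d"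
      show "weight_value (surgery1 D a c d) (P surgery1 {c, d})"
        by (rule P[where f = surgery1, OF surgery_commute(1) IH[OF surg(1)[OF cd]] cd])
      show "weight_value (surgery2 D a c d) (P surgery2 {c, d})"
        by (rule P[where f = surgery2, OF surgery_commute(2) IH[OF surg(2)[OF cd]] cd])
    qed
    then show ?thesis ..
  qed
qed simp

text \<open>Passes from ordered pairs of crossing chords to the two-element sets of the recursion.\<close>

lemma sum_two_element_subsets:
  fixes f :: "'a set \<Rightarrow> complex"
  assumes "finite I"
  shows "(\<Sum>c\<in>I. \<Sum>d\<in>I - {c}. f {c, d}) = 2 * (\<Sum>S | S \<subseteq> I \<and> card S = 2. f S)"
  using assms
proof (induction I rule: finite_induct)
  case empty
  have "{S :: 'a set. S \<subseteq> {} \<and> card S = 2} = {}" by auto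
  then show ?case by (simp only:) simp
next
  case (insert x I)
  have "{S. S \<subseteq> insert x I \<and> card S = 2} = {S. S \<subseteq> I \<and> card S = 2} \<union> (\<lambda>d. {x, d}) ` I"
    using insert.hyps(2) by (auto simp: card_2_iff subset_insert_iff doubleton_eq_iff)
  moreover have "{S. S \<subseteq> I \<and> card S = 2} \<inter> (\<lambda>d. {x, d}) ` I = {}" using insert.hyps(2) by auto
  moreover have "finite {S. S \<subseteq> I \<and> card S = 2}" using insert.hyps(1) by simp
  moreover have "inj_on (\<lambda>d. {x, d}) I" by (auto simp: inj_on_def doubleton_eq_iff)
  ultimately have R: "(\<Sum>S | S \<subseteq> insert x I \<and> card S = 2. f S)
      = (\<Sum>S | S \<subseteq> I \<and> card S = 2. f S) + (\<Sum>d\<in>I. f {x, d})"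
    using insert.hyps(1) by (simp add: sum.union_disjoint sum.reindex)
  have "(\<Sum>d\<in>insert x I - {c}. f {c, d}) = f {x, c} + (\<Sum>d\<in>I - {c}. f {c, d})" if "c \<in> I" for c
  proof -
    have "insert x I - {c} = insert x (I - {c})" using that insert.hyps(2) by auto
    then show ?thesis using insert.hyps by (simp add: insert_commute)
  qed
  moreover have "insert x I - {x} = I" using insert.hyps(2) by auto
  ultimately have "(\<Sum>c\<in>insert x I. \<Sum>d\<in>insert x I - {c}. f {c, d})
     = (\<Sum>d\<in>I. f {x, d}) + (\<Sum>c\<in>I. f {x, c} + (\<Sum>d\<in>I - {c}. f {c, d}))"
    using insert.hyps by (simp del: insert_Diff_if)
  then show ?case unfolding R using insert.IH by (simp add: sum.distrib algebra_simps)
qed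

definition eval_int_poly :: "complex \<Rightarrow> int poly \<Rightarrow> complex" where
  "eval_int_poly x p = poly (map_poly of_int p) x"

lemma eval_int_poly_add: "eval_int_poly x (p + q) = eval_int_poly x p + eval_int_poly x q"
proof -
  have "map_poly of_int (p + q) = map_poly of_int p + (map_poly of_int q :: complex poly)"
    by (rule poly_eqI) (simp add: coeff_map_poly)
  then show ?thesis by (simp add: eval_int_poly_def)
qed

lemma eval_int_poly_mult: "eval_int_poly x (p * q) = eval_int_poly x p * eval_int_poly x q"
proof -
  have "map_poly of_int (p * q) = map_poly of_int p * (map_poly of_int q :: complex poly)"
    by (rule poly_eqI) (simp add: coeff_map_poly coeff_mult)
  then show ?thesis by (simp add: eval_int_poly_def)
qed

lemma eval_int_poly_diff: "eval_int_poly x (p - q) = eval_int_poly x p - eval_int_poly x q"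
proof -
  have "map_poly of_int (p - q) = map_poly of_int p - (map_poly of_int q :: complex poly)"
    by (rule poly_eqI) (simp add: coeff_map_poly)
  then show ?thesis by (simp add: eval_int_poly_def)
qed

lemma eval_int_poly_sum: "eval_int_poly x (\<Sum>i\<in>A. p i) = (\<Sum>i\<in>A. eval_int_poly x (p i))"
  by (induction A rule: infinite_finite_induct) (simp_all add: eval_int_poly_add, simp_all add: eval_int_poly_def)

lemma eval_int_poly_X_minus: "eval_int_poly x ([:0, 1:] - of_nat k) = x - of_nat k"
proof -
  have "eval_int_poly x (of_nat k) = of_nat k" by (simp add: eval_int_poly_def of_nat_poly map_poly_pCons)
  then show ?thesis unfolding eval_int_poly_diff by (simp add: eval_int_poly_def map_poly_pCons)
qed

context so3_functional begin

lemma diagram_sum_empty: "diagram_sum {} = 1"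
proof -
  have "labellings {} = {\<lambda>_. undefined}"
    unfolding labellings_def constant_on_chords_def extensional_def by (auto simp: fun_eq_iff)
  then show ?thesis by (simp add: diagram_sum_def)
qed

text \<open>Every polynomial that the recursion can produce has the state sum as its value at \<open>x\<close>, whichever
  chords were chosen.\<close>

lemma eval_weight_value: "weight_value D p \<Longrightarrow> eval_int_poly x p = diagram_sum D"
proof (induction rule: weight_value.induct)
  case (single D)
  then obtain a where a: "D = {a}" unfolding chord_diagram_def by (metis card_1_singletonE)
  have "crossing_chords D a = {}" unfolding a crossing_chords_def by auto
  then show ?case
    using diagram_sum_recursion[OF single, of a]
    by (simp add: a diagram_sum_empty eval_int_poly_def map_poly_pCons)
next
  case (step n D a p P Q)
  let ?I = "crossing_chords D a" and ?ev = "eval_int_poly x"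
  have fin: "finite ?I"
    using step.hyps(1) unfolding chord_diagram_def crossing_chords_def by simp
  have "(\<Sum>c\<in>?I. \<Sum>d\<in>?I - {c}. diagram_sum (surgery1 D a c d) - diagram_sum (surgery2 D a c d))
     = (\<Sum>c\<in>?I. \<Sum>d\<in>?I - {c}. ?ev (P {c, d}) - ?ev (Q {c, d}))"
  proof (intro sum.cong refl)
    fix c d assume "c \<in> ?I" "d \<in> ?I - {c}"
    then have cd: "c \<in> ?I" "d \<in> ?I" "c \<noteq> d" by auto
    show "diagram_sum (surgery1 D a c d) - diagram_sum (surgery2 D a c d) = ?ev (P {c, d}) - ?ev (Q {c, d})"
      unfolding step.IH(2)[OF cd] step.IH(3)[OF cd] ..
  qed
  also have "\<dots> = 2 * (\<Sum>S | S \<subseteq> ?I \<and> card S = 2. ?ev (P S) - ?ev (Q S))"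
    by (rule sum_two_element_subsets[OF fin])
  finally have "2 * diagram_sum D = 2 * ((x - of_nat (card ?I)) * ?ev p
      + (\<Sum>S | S \<subseteq> ?I \<and> card S = 2. ?ev (P S) - ?ev (Q S)))"
    unfolding diagram_sum_recursion[OF step.hyps(1,3)] step.IH(1) by (simp add: algebra_simps)
  then have "diagram_sum D = (x - of_nat (card ?I)) * ?ev p
      + (\<Sum>S | S \<subseteq> ?I \<and> card S = 2. ?ev (P S) - ?ev (Q S))"
    unfolding mult_cancel_left by simp
  then show ?case
    unfolding eval_int_poly_add eval_int_poly_mult eval_int_poly_sum eval_int_poly_X_minus
      eval_int_poly_diff[of x "P _"] by (rule sym)
qed

end

section \<open>A module with arbitrary Casimir eigenvalue\<close>

context fixes l :: complex begin

text \<open>A module of highest weight \<open>l\<close> on power series: the sequence \<open>v\<close> stands for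
  \<open>\<Sum>m. v m z^m\<close>, with \<open>d/dz\<close> as raising operator, \<open>2 l z - z^2 d/dz\<close> as lowering operator and
  \<open>l - z d/dz\<close> as half of the Cartan element.\<close>

definition raising :: "(nat \<Rightarrow> complex) \<Rightarrow> nat \<Rightarrow> complex" where
  "raising v = (\<lambda>m. of_nat (m + 1) * v (m + 1))"

definition lowering :: "(nat \<Rightarrow> complex) \<Rightarrow> nat \<Rightarrow> complex" where
  "lowering v = (\<lambda>m. if m = 0 then 0 else (2 * l - of_nat m + 1) * v (m - 1))"

definition cartan :: "(nat \<Rightarrow> complex) \<Rightarrow> nat \<Rightarrow> complex" where
  "cartan v = (\<lambda>m. (l - of_nat m) * v m)"

fun act :: "axis \<Rightarrow> (nat \<Rightarrow> complex) \<Rightarrow> nat \<Rightarrow> complex" where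
  "act Ax1 v = (\<lambda>m. (raising v m + lowering v m) / 2)"
| "act Ax2 v = (\<lambda>m. (raising v m - lowering v m) / (2 * \<i>))"
| "act Ax3 v = cartan v"

definition act_word :: "axis list \<Rightarrow> (nat \<Rightarrow> complex) \<Rightarrow> nat \<Rightarrow> complex" where
  "act_word w v = foldr act w v"

definition vacuum :: "axis list \<Rightarrow> complex" where
  "vacuum w = act_word w (\<lambda>m. if m = 0 then 1 else 0) 0"

lemma act_word_simps [simp]: "act_word [] v = v" "act_word (a # w) v = act a (act_word w v)"
  "act_word (u @ w) v = act_word u (act_word w v)"
  by (simp_all add: act_word_def)

lemma act_linear: "act a (\<lambda>m. \<Sum>i\<in>I. c i * f i m) = (\<lambda>m. \<Sum>i\<in>I. c i * act a (f i) m)"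
proof -
  have "raising (\<lambda>m. \<Sum>i\<in>I. c i * f i m) = (\<lambda>m. \<Sum>i\<in>I. c i * raising (f i) m)"
    "lowering (\<lambda>m. \<Sum>i\<in>I. c i * f i m) = (\<lambda>m. \<Sum>i\<in>I. c i * lowering (f i) m)"
    "cartan (\<lambda>m. \<Sum>i\<in>I. c i * f i m) = (\<lambda>m. \<Sum>i\<in>I. c i * cartan (f i) m)"
    by (auto simp: raising_def lowering_def cartan_def sum_distrib_left mult.left_commute fun_eq_iff)
  then show ?thesis
    by (cases a) (simp_all add: sum_divide_distrib algebra_simps add_divide_distrib diff_divide_distrib
        flip: sum.distrib sum_subtractf)
qed

lemma act_word_linear:
  "act_word w (\<lambda>m. \<Sum>i\<in>I. c i * f i m) = (\<lambda>m. \<Sum>i\<in>I. c i * act_word w (f i) m)"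
  by (induction w) (simp_all add: act_linear)

lemma act_commutator:
  "act a (act b v) m = act b (act a v) m + \<i> * (\<Sum>g\<in>UNIV. eps a b g * act g v m)"
  by (cases a; cases b; cases m)
    (simp_all add: sum_axis raising_def lowering_def cartan_def field_simps)

lemma act_casimir: "(\<Sum>a\<in>UNIV. act a (act a v) m) = l * (l + 1) * v m"
  by (cases m) (simp_all add: sum_axis raising_def lowering_def cartan_def field_simps)

end

definition basis_vec :: "nat \<Rightarrow> nat \<Rightarrow> complex" where
  "basis_vec k = (\<lambda>m. if m = k then 1 else 0)"

lemma vacuum_basis: "vacuum l w = act_word l w (basis_vec 0) 0"
  by (simp add: vacuum_def basis_vec_def)

lemma act_word_add: "act_word l w (\<lambda>m. f m + c * g m) = (\<lambda>m. act_word l w f m + c * act_word l w g m)"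
  using act_word_linear[of l w "\<lambda>i. if i = 0 then 1 else c" "\<lambda>i. if i = 0 then f else g" "{0, 1::nat}"]
  by simp

lemma so3_functional_vacuum: "so3_functional (vacuum l) (l * (l + 1))"
proof
  fix u w :: "axis list" and a b :: axis
  let ?v = "act_word l w (basis_vec 0)"
  have "act l a (act l b ?v) = (\<lambda>m. act l b (act l a ?v) m + \<i> * (\<Sum>g\<in>UNIV. eps a b g * act l g ?v m))"
    by (rule ext) (rule act_commutator)
  then show "vacuum l (u @ a # b # w) =
      vacuum l (u @ b # a # w) + \<i> * (\<Sum>g\<in>UNIV. eps a b g * vacuum l (u @ g # w))"
    by (simp add: vacuum_basis act_word_add act_word_linear)
next
  fix u w :: "axis list"
  let ?v = "act_word l w (basis_vec 0)"
  have "(\<lambda>m. \<Sum>a\<in>UNIV. 1 * act l a (act l a ?v) m) = (\<lambda>m. \<Sum>a\<in>{Ax1}. (l * (l + 1)) * ?v m)"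
    by (simp add: act_casimir)
  then have "act_word l u (\<lambda>m. \<Sum>a\<in>UNIV. 1 * act l a (act l a ?v) m) 0
     = act_word l u (\<lambda>m. \<Sum>a\<in>{Ax1}. (l * (l + 1)) * ?v m) 0" by (simp only:)
  then show "(\<Sum>a\<in>UNIV. vacuum l (u @ a # a # w)) = l * (l + 1) * vacuum l (u @ w)"
    unfolding act_word_linear by (simp add: vacuum_basis)
qed (simp add: vacuum_def)

text \<open>The equation \<open>l (l + 1) = x\<close> is solvable for every \<open>x\<close>, so two candidate polynomials agree everywhere.\<close>

lemma weight_value_unique:
  assumes "weight_value D p" "weight_value D q"
  shows "p = q"
proof -
  have "poly (map_poly of_int p) x = (poly (map_poly of_int q) x :: complex)" for x
  proof -
    define l where "l = (csqrt (1 + 4 * x) - 1) / 2"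
    have "l * (l + 1) = ((csqrt (1 + 4 * x)) ^ 2 - 1) / 4"
      by (simp add: l_def power2_eq_square field_simps)
    then have l: "l * (l + 1) = x" by simp
    interpret so3_functional "vacuum l" "l * (l + 1)" by (rule so3_functional_vacuum)
    show ?thesis
      using eval_weight_value[OF assms(1)] eval_weight_value[OF assms(2)]
      unfolding eval_int_poly_def l by simp
  qed
  then have "map_poly of_int p = (map_poly of_int q :: complex poly)"
    by (intro iffD1[OF poly_eq_poly_eq_iff] ext)
  then have "of_int (coeff p i) = (of_int (coeff q i) :: complex)" for i
    by (metis coeff_map_poly of_int_0)
  then show ?thesis by (intro poly_eqI) simp
qed

section \<open>The state sum of the complete diagram\<close>

lemma chord_diagram_complete: "chord_diagram n (complete_diagram n)"
proof -
  have "inj_on (\<lambda>i. {i, n + i}) {1..n}" by (auto simp: inj_on_def doubleton_eq_iff)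
  then have "card (complete_diagram n) = n" unfolding complete_diagram_def by (simp add: card_image)
  moreover have "pairwise disjnt (complete_diagram n)"
    unfolding complete_diagram_def pairwise_def disjnt_def by auto
  ultimately show ?thesis unfolding chord_diagram_def complete_diagram_def by auto
qed


lemma act_word_support: "m > k + length w \<Longrightarrow> act_word l w (basis_vec k) m = 0"
proof (induction w arbitrary: m)
  case Nil
  then show ?case by (simp add: basis_vec_def)
next
  case (Cons a w)
  then have "act_word l w (basis_vec k) m' = 0" if "m' + 1 \<ge> m" for m'
    using that by simp
  then show ?case by (cases a) (simp_all add: raising_def lowering_def cartan_def)
qed

text \<open>The matrix entry of \<open>\<Sum>w. w \<otimes> w\<close> that takes \<open>y^k\<close> to \<open>y^m z^r\<close>.\<close>

definition pairing :: "complex \<Rightarrow> nat \<Rightarrow> nat \<Rightarrow> nat \<Rightarrow> nat \<Rightarrow> complex" where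
  "pairing l n k m r =
     (\<Sum>w | length w = n. act_word l w (basis_vec k) m * act_word l w (basis_vec 0) r)"

lemma sum_words_Suc: "(\<Sum>w | length w = Suc n. f w) = (\<Sum>w | length w = n. \<Sum>a\<in>(UNIV :: axis set). f (a # w))"
proof -
  have "(\<Sum>w | length w = n. \<Sum>a\<in>UNIV. f (a # w)) = (\<Sum>(w, a)\<in>{w. length w = n} \<times> (UNIV :: axis set). f (a # w))"
    by (rule sum.cartesian_product)
  also have "\<dots> = (\<Sum>w | length w = Suc n. f w)"
    by (rule sum.reindex_bij_witness[where i = "\<lambda>w. (tl w, hd w)" and j = "\<lambda>(w, a). a # w"])
      (auto simp: length_Suc_conv)
  finally show ?thesis by simp
qed

text \<open>Inserting a basis between the two copies of \<open>w\<close> turns the product into a tensor product.\<close>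

lemma sum_vacuum_square:
  "(\<Sum>w | length w = n. vacuum l (w @ w)) = (\<Sum>k\<le>n. pairing l n k 0 k)"
proof -
  have "vacuum l (w @ w) = (\<Sum>k\<le>n. act_word l w (basis_vec k) 0 * act_word l w (basis_vec 0) k)"
    if w: "length w = n" for w
  proof -
    let ?v = "act_word l w (basis_vec 0)"
    have "(\<Sum>k\<le>n. ?v k * basis_vec k m) = ?v m" for m
    proof -
      have "(\<Sum>k\<le>n. ?v k * basis_vec k m) = (\<Sum>k\<le>n. if k = m then ?v k else 0)"
        by (intro sum.cong) (auto simp: basis_vec_def)
      then show ?thesis using act_word_support[of 0 w m l] w by (simp add: not_le)
    qed
    then have "?v = (\<lambda>m. \<Sum>k\<le>n. ?v k * basis_vec k m)" by (simp only:)
    then have "act_word l w ?v 0 = act_word l w (\<lambda>m. \<Sum>k\<le>n. ?v k * basis_vec k m) 0"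
      by (rule arg_cong[where f = "\<lambda>v. act_word l w v 0"])
    also have "\<dots> = (\<Sum>k\<le>n. act_word l w (basis_vec k) 0 * ?v k)"
      unfolding act_word_linear by (simp only: mult.commute)
    finally show ?thesis by (simp add: vacuum_basis)
  qed
  then have "(\<Sum>w | length w = n. vacuum l (w @ w)) =
    (\<Sum>w | length w = n. \<Sum>k\<le>n. act_word l w (basis_vec k) 0 * act_word l w (basis_vec 0) k)"
    by (intro sum.cong) auto
  then show ?thesis unfolding pairing_def by (subst sum.swap)
qed

lemma act_tensor: "(\<Sum>a\<in>UNIV. act l a f m * act l a g r)
    = (raising f m * lowering l g r + lowering l f m * raising g r) / 2 + cartan l f m * cartan l g r"
  by (simp add: sum_axis field_simps)

lemma pairing_0: "pairing l 0 k m r = (if m = k \<and> r = 0 then 1 else 0)"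
  by (simp add: pairing_def basis_vec_def)

lemma pairing_Suc: "pairing l (Suc n) k m r =
    (of_nat (m + 1) * (if r = 0 then 0 else (2 * l - of_nat r + 1) * pairing l n k (m + 1) (r - 1))
     + (if m = 0 then 0 else (2 * l - of_nat m + 1) * (of_nat (r + 1) * pairing l n k (m - 1) (r + 1)))) / 2
    + (l - of_nat m) * (l - of_nat r) * pairing l n k m r"
proof -
  have "pairing l (Suc n) k m r = (\<Sum>w | length w = n.
      (raising (act_word l w (basis_vec k)) m * lowering l (act_word l w (basis_vec 0)) r
       + lowering l (act_word l w (basis_vec k)) m * raising (act_word l w (basis_vec 0)) r) / 2
       + cartan l (act_word l w (basis_vec k)) m * cartan l (act_word l w (basis_vec 0)) r)"
    unfolding pairing_def sum_words_Suc by (simp only: act_word_simps act_tensor)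
  then show ?thesis
    unfolding pairing_def raising_def lowering_def cartan_def
    by (simp add: sum.distrib sum_distrib_left mult_ac flip: sum_divide_distrib)
qed

text \<open>The entries, as polynomials in the weight \<open>l\<close>, of the powers of the bidiagonal matrix of
  \<open>\<Sum>a. J\<^sub>a \<otimes> J\<^sub>a\<close>. The diagonal entry at \<open>i\<close> is \<open>j (j + 1) / 2 - l (l + 1)\<close> with \<open>j = 2 l - i\<close>, its
  eigenvalue on the component of highest weight \<open>j\<close> of the tensor square.\<close>

fun transfer_poly :: "nat \<Rightarrow> nat \<Rightarrow> complex poly" where
  "transfer_poly 0 i = (if i = 0 then 1 else 0)"
| "transfer_poly (Suc n) i =
     [:of_nat i * (of_nat i - 1) / 2, - 2 * of_nat i, 1:] * transfer_poly n i
     + (case i of 0 \<Rightarrow> 0 | Suc j \<Rightarrow> [:- (of_nat i * of_nat j / 2), of_nat i:] * transfer_poly n j)"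

lemma transfer_poly_eq_0: "i > n \<Longrightarrow> transfer_poly n i = 0"
  by (induction n arbitrary: i) (auto split: nat.split)

text \<open>The coefficient of \<open>y^(k-r) z^r\<close> in \<open>binomial(k, i) (z - y)^i y^(k-i)\<close>.\<close>

definition kernel_coeff :: "nat \<Rightarrow> nat \<Rightarrow> nat \<Rightarrow> complex" where
  "kernel_coeff k i r = (-1) ^ (i + r) * of_nat (k choose i) * of_nat (i choose r)"

lemma choose_Suc_right: "of_nat (Suc r) * of_nat (i choose Suc r) = ((of_nat i - of_nat r) * of_nat (i choose r) :: complex)"
proof -
  have "Suc r * ((i choose r) + (i choose Suc r)) = Suc i * (i choose r)"
    using Suc_times_binomial[of r i] by simp
  then have "of_nat (Suc r) * (of_nat (i choose r) + of_nat (i choose Suc r)) = (of_nat (Suc i) * of_nat (i choose r) :: complex)"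
    by (metis of_nat_add of_nat_mult)
  then show ?thesis by (simp add: algebra_simps)
qed

text \<open>The bidiagonal action on the kernels, read off coefficientwise. After writing all binomial
  coefficients in terms of \<open>p = binomial(i, r-1)\<close> and \<open>q = binomial(i, r)\<close>, the difference of the two sides is
  a multiple of the absorption identity \<open>r q = (i - r + 1) p\<close>.\<close>

lemma kernel_coeff_step:
  assumes "m + r = k"
  shows "(of_nat (m + 1) * (if r = 0 then 0 else (2 * l - of_nat r + 1) * kernel_coeff k i (r - 1))
     + (if m = 0 then 0 else (2 * l - of_nat m + 1) * (of_nat (r + 1) * kernel_coeff k i (r + 1)))) / 2
    + (l - of_nat m) * (l - of_nat r) * kernel_coeff k i r
    = (l ^ 2 - 2 * of_nat i * l + of_nat i * (of_nat i - 1) / 2) * kernel_coeff k i r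
      + of_nat (i + 1) * (l - of_nat i / 2) * kernel_coeff k (Suc i) r"
proof -
  define p :: complex where "p = (if r = 0 then 0 else of_nat (i choose (r - 1)))"
  define q :: complex where "q = of_nat (i choose r)"
  define S :: complex where "S = (-1) ^ (i + r) * of_nat (k choose i)"
  let ?M = "of_nat m :: complex" and ?R = "of_nat r :: complex" and ?I = "of_nat i :: complex"
  have h: "?R * q = (?I - ?R + 1) * p"
    using choose_Suc_right[of "r - 1" i] by (cases r) (simp_all add: p_def q_def)
  have pq: "of_nat (Suc i choose r) = p + q"
    by (cases r) (simp_all add: p_def q_def)
  have A: "(if r = 0 then 0 else (2 * l - ?R + 1) * kernel_coeff k i (r - 1)) = - S * ((2 * l - ?R + 1) * p)"
    by (cases r) (simp_all add: kernel_coeff_def p_def S_def)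
  have B: "(if m = 0 then 0 else (2 * l - ?M + 1) * (of_nat (r + 1) * kernel_coeff k i (r + 1)))
      = - S * ((2 * l - ?M + 1) * ((?I - ?R) * q))"
  proof -
    have "of_nat (r + 1) * kernel_coeff k i (r + 1) = - S * (of_nat (Suc r) * of_nat (i choose Suc r))"
      by (simp add: kernel_coeff_def S_def)
    then have *: "of_nat (r + 1) * kernel_coeff k i (r + 1) = - S * ((?I - ?R) * q)"
      unfolding choose_Suc_right q_def .
    show ?thesis
    proof (cases "m = 0")
      case True
      have "kernel_coeff k i (r + 1) = 0"
        using True assms by (cases "i \<le> k") (simp_all add: kernel_coeff_def)
      with * have "S * ((?I - ?R) * q) = 0" by simp
      then show ?thesis using True by (auto simp: mult.left_commute)
    next
      case False
      show ?thesis unfolding * using False by (simp add: mult_ac)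
    qed
  qed
  have C: "kernel_coeff k i r = S * q" by (simp add: kernel_coeff_def S_def q_def)
  have D: "of_nat (i + 1) * kernel_coeff k (Suc i) r = - S * ((?M + ?R - ?I) * (p + q))"
  proof -
    have "of_nat (i + 1) * kernel_coeff k (Suc i) r
      = - ((-1) ^ (i + r)) * (of_nat (Suc i) * of_nat (k choose Suc i)) * of_nat (Suc i choose r)"
      by (simp add: kernel_coeff_def)
    then show ?thesis
      unfolding choose_Suc_right pq S_def assms[symmetric] by (simp add: mult_ac)
  qed
  have E: "of_nat (i + 1) * (l - ?I / 2) * kernel_coeff k (Suc i) r = - S * ((?M + ?R - ?I) * (p + q)) * (l - ?I / 2)"
    unfolding D[symmetric] by simp
  have "((?M + 1) * (- S * ((2 * l - ?R + 1) * p)) + - S * ((2 * l - ?M + 1) * ((?I - ?R) * q))) / 2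
     + (l - ?M) * (l - ?R) * (S * q)
     - ((l ^ 2 - 2 * ?I * l + ?I * (?I - 1) / 2) * (S * q) + - S * ((?M + ?R - ?I) * (p + q)) * (l - ?I / 2))
     = - S * (2 * l + ?M + 1 - ?I) / 2 * ((?I - ?R + 1) * p - ?R * q)"
    by (simp add: field_simps power2_eq_square)
  also have "\<dots> = 0" unfolding h by simp
  finally show ?thesis unfolding A B C E right_minus_eq of_nat_add[of m 1] of_nat_1 .
qed

text \<open>At \<open>m = 0\<close>, \<open>r = k\<close> only the kernel \<open>i = k\<close> has a nonzero coefficient, so the sum over \<open>k\<close> of these
  entries is the sum of the transfer polynomials.\<close>

lemma pairing_eq: "pairing l n k m r =
    (if m + r = k then \<Sum>i\<le>n. poly (transfer_poly n i) l * kernel_coeff k i r else 0)"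
proof (induction n arbitrary: m r)
  case 0
  have "kernel_coeff k 0 r = (if r = 0 then 1 else 0)" by (cases r) (simp_all add: kernel_coeff_def)
  then show ?case by (auto simp: pairing_0)
next
  case (Suc n)
  show ?case
  proof (cases "m + r = k")
    case False
    then show ?thesis unfolding pairing_Suc by (cases r; cases m) (simp_all add: Suc.IH)
  next
    case True
    let ?t = "\<lambda>n i. poly (transfer_poly n i) l"
    let ?mu = "\<lambda>i. l ^ 2 - 2 * of_nat i * l + of_nat i * (of_nat i - 1) / 2"
    let ?nu = "\<lambda>i. of_nat (i + 1) * (l - of_nat i / 2)"
    have IH: "pairing l n k m' r' = (\<Sum>i\<le>n. ?t n i * kernel_coeff k i r')" if "m' + r' = k" for m' r'
      using that by (simp add: Suc.IH)
    have "pairing l (Suc n) k m r = (\<Sum>i\<le>n. ?t n i *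
      ((of_nat (m + 1) * (if r = 0 then 0 else (2 * l - of_nat r + 1) * kernel_coeff k i (r - 1))
     + (if m = 0 then 0 else (2 * l - of_nat m + 1) * (of_nat (r + 1) * kernel_coeff k i (r + 1)))) / 2
    + (l - of_nat m) * (l - of_nat r) * kernel_coeff k i r))"
    proof -
      have 1: "(if r = 0 then 0 else (2 * l - of_nat r + 1) * pairing l n k (m + 1) (r - 1))
        = (\<Sum>i\<le>n. ?t n i * (if r = 0 then 0 else (2 * l - of_nat r + 1) * kernel_coeff k i (r - 1)))"
        using True by (cases r) (simp_all add: IH sum_distrib_left mult_ac)
      have 2: "(if m = 0 then 0 else (2 * l - of_nat m + 1) * (of_nat (r + 1) * pairing l n k (m - 1) (r + 1)))
        = (\<Sum>i\<le>n. ?t n i * (if m = 0 then 0 else (2 * l - of_nat m + 1) * (of_nat (r + 1) * kernel_coeff k i (r + 1))))"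
        using True by (cases m) (simp_all add: IH sum_distrib_left mult_ac)
      show ?thesis
        unfolding pairing_Suc 1 2 IH[OF True]
        by (simp only: sum_distrib_left sum_divide_distrib flip: sum.distrib)
          (intro sum.cong refl, simp only: algebra_simps add_divide_distrib times_divide_eq_right)
    qed
    also have "\<dots> = (\<Sum>i\<le>n. ?t n i * (?mu i * kernel_coeff k i r + ?nu i * kernel_coeff k (Suc i) r))"
      by (simp only: kernel_coeff_step[OF True])
    also have "\<dots> = (\<Sum>i\<le>Suc n. ?mu i * ?t n i * kernel_coeff k i r)
        + (\<Sum>i\<le>n. ?nu i * ?t n i * kernel_coeff k (Suc i) r)"
      by (simp add: distrib_left sum.distrib transfer_poly_eq_0 mult_ac)
    also have "\<dots> = (\<Sum>i\<le>Suc n. ?t (Suc n) i * kernel_coeff k i r)"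
    proof -
      have "?t (Suc n) 0 = ?mu 0 * ?t n 0" by (simp add: power2_eq_square)
      moreover have "?t (Suc n) (Suc j) = ?mu (Suc j) * ?t n (Suc j) + ?nu j * ?t n j" for j
        by (simp add: power2_eq_square field_simps)
      ultimately show ?thesis
        unfolding sum.atMost_Suc_shift[of _ n]
        by (simp only: distrib_right sum.distrib add.assoc)
    qed
    finally show ?thesis using True by simp
  qed
qed

lemma sum_vacuum_square_eq:
  "(\<Sum>w | length w = n. vacuum l (w @ w)) = (\<Sum>i\<le>n. poly (transfer_poly n i) l)"
proof -
  have "pairing l n k 0 k = poly (transfer_poly n k) l" if "k \<le> n" for k
  proof -
    have "kernel_coeff k i k = (if i = k then 1 else 0)" for i
      by (cases i k rule: linorder_cases) (simp_all add: kernel_coeff_def flip: mult_2)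
    moreover have "(\<Sum>i\<le>n. c i * (if i = k then 1 else 0)) = c k" for c :: "nat \<Rightarrow> complex"
    proof -
      have "(\<Sum>i\<le>n. c i * (if i = k then 1 else 0)) = (\<Sum>i\<le>n. if i = k then c i else 0)"
        by (intro sum.cong) auto
      then show ?thesis using that by simp
    qed
    ultimately show ?thesis by (simp only: pairing_eq add_0 if_True simp_thms)
  qed
  then show ?thesis by (simp add: sum_vacuum_square)
qed

context so3_functional begin

text \<open>A labelling of the complete diagram is an arbitrary word on the first \<open>n\<close> points, repeated on the
  last \<open>n\<close>.\<close>

lemma diagram_sum_complete:
  "diagram_sum (complete_diagram n) = (\<Sum>w | length w = n. \<psi> (w @ w))"
proof -
  have U: "\<Union>(complete_diagram n) = {1..<2 * n + 1}"
  proof -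
    have "v \<in> \<Union>(complete_diagram n)" if "v \<in> {1..<2 * n + 1}" for v
    proof (cases "v \<le> n")
      case True
      then show ?thesis using that unfolding complete_diagram_def by auto
    next
      case False
      then have "v - n \<in> {1..n}" "v = n + (v - n)" using that by auto
      then show ?thesis unfolding complete_diagram_def by blast
    qed
    then show ?thesis unfolding complete_diagram_def by auto
  qed
  have S: "s \<in> labellings (complete_diagram n) \<longleftrightarrow>
      s \<in> extensional {1..<2 * n + 1} \<and> (\<forall>i\<in>{1..n}. s i = s (n + i))" for s
    unfolding labellings_def constant_on_chords_def U mem_Collect_eq
    by (auto simp: complete_diagram_def)
  have split: "map s [1..<2 * n + 1] = map s [1..<n + 1] @ map s [1..<n + 1]"
    if "s \<in> labellings (complete_diagram n)" for s
  proof (rule nth_equalityI)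
    fix i assume "i < length (map s [1..<2 * n + 1])"
    moreover have "s (1 + (i - n)) = s (n + (1 + (i - n)))" if "\<not> i < n" "i < 2 * n"
      using \<open>s \<in> _\<close> that S by auto
    ultimately show "map s [1..<2 * n + 1] ! i = (map s [1..<n + 1] @ map s [1..<n + 1]) ! i"
      by (cases "i < n") (auto simp: nth_append simp del: upt_Suc)
  qed simp
  let ?i = "\<lambda>w v. if v \<in> {1..n} then w ! (v - 1) else if v \<in> {n + 1..2 * n} then w ! (v - n - 1) else undefined"
  let ?j = "\<lambda>s. map s [1..<n + 1]"
  have "diagram_sum (complete_diagram n) = (\<Sum>s\<in>labellings (complete_diagram n). \<psi> (?j s @ ?j s))"
    unfolding diagram_sum_def U sorted_list_of_set_range using split by (intro sum.cong) auto
  also have "\<dots> = (\<Sum>w | length w = n. \<psi> (w @ w))"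
  proof (rule sum.reindex_bij_witness[where i = ?i and j = ?j])
    fix s assume "s \<in> labellings (complete_diagram n)"
    then have sS: "s \<in> extensional {1..<2 * n + 1}" "\<forall>i\<in>{1..n}. s i = s (n + i)"
      using S by auto
    show "?i (?j s) = s"
    proof
      fix v
      consider "v \<in> {1..n}" | "v \<in> {n + 1..2 * n}" | "v \<notin> {1..<2 * n + 1}" by fastforce
      then show "?i (?j s) v = s v"
      proof cases
        case 1
        then show ?thesis by (auto simp del: upt_Suc)
      next
        case 2
        then have "Suc (v - Suc n) = v - n" by auto
        then show ?thesis using 2 bspec[OF sS(2), of "v - n"] by (auto simp del: upt_Suc)
      next
        case 3
        then show ?thesis using extensional_arb[OF sS(1) 3] by auto
      qed
    qed
  next
    fix w :: "axis list" assume "w \<in> {w. length w = n}"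
    then have w: "length w = n" by simp
    show "?j (?i w) = w" by (rule nth_equalityI) (use w in \<open>auto simp del: upt_Suc\<close>)
    show "?i w \<in> labellings (complete_diagram n)" unfolding S by (auto simp: extensional_def)
  qed auto
  finally show ?thesis .
qed

end

lemma eval_weight_value_complete:
  assumes "weight_value (complete_diagram n) p"
  shows "eval_int_poly (l * (l + 1)) p = (\<Sum>i\<le>n. poly (transfer_poly n i) l)"
proof -
  interpret so3_functional "vacuum l" "l * (l + 1)" by (rule so3_functional_vacuum)
  show ?thesis
    unfolding eval_weight_value[OF assms] diagram_sum_complete by (rule sum_vacuum_square_eq)
qed

section \<open>The Genocchi functional and the Seidel triangle\<close>

text \<open>The operator \<open>F(v) \<mapsto> F(v) + F(v + 1)\<close>, which doubles leading coefficients and is therefore bijective.\<close>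

definition shift_sum :: "complex poly \<Rightarrow> complex poly" where
  "shift_sum F = F + pcompose F [:1, 1:]"

lemma pcompose_power: "pcompose (p ^ n) q = pcompose p q ^ n" for p q :: "complex poly"
  by (induction n) (simp_all add: pcompose_mult one_pCons pcompose_pCons)

lemma shift_sum_add: "shift_sum (F + G) = shift_sum F + shift_sum G"
  by (simp add: shift_sum_def pcompose_add)

lemma shift_sum_smult: "shift_sum (smult c F) = smult c (shift_sum F)"
  by (simp add: shift_sum_def pcompose_smult smult_add_right)

lemma coeff_shift_sum: "coeff (shift_sum F) (degree F) = 2 * lead_coeff F"
proof -
  have "lead_coeff (pcompose F [:1, 1:]) = lead_coeff F"
    by (subst lead_coeff_comp) auto
  moreover have "degree (pcompose F [:1, 1:]) = degree F" by (simp add: degree_pcompose)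
  ultimately show ?thesis by (simp add: shift_sum_def)
qed

lemma shift_sum_eq_0_iff: "shift_sum F = 0 \<longleftrightarrow> F = 0"
proof
  assume "shift_sum F = 0"
  then show "F = 0" using coeff_shift_sum[of F] by simp
qed (simp add: shift_sum_def)

lemma degree_shift_sum: "degree (shift_sum F) = degree F"
proof (rule antisym)
  show "degree (shift_sum F) \<le> degree F"
    unfolding shift_sum_def by (rule degree_add_le) (simp_all add: degree_pcompose)
  show "degree F \<le> degree (shift_sum F)"
    using coeff_shift_sum[of F] by (cases "F = 0") (auto intro: le_degree)
qed

lemma shift_sum_surj: "\<exists>F. shift_sum F = f"
proof (induction "degree f" arbitrary: f rule: less_induct)
  case less
  show ?case
  proof (cases "degree f = 0")
    case True
    then obtain c where "f = [:c:]" by (metis degree_eq_zeroE)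
    then have "shift_sum [:c / 2:] = f" by (simp add: shift_sum_def)
    then show ?thesis ..
  next
    case False
    let ?F = "smult (1/2) f"
    have "degree (f - shift_sum ?F) \<le> degree f"
      by (intro degree_diff_le) (simp_all add: degree_shift_sum)
    moreover have "coeff (f - shift_sum ?F) (degree f) = 0"
      using coeff_shift_sum[of ?F] by simp
    ultimately have "degree (f - shift_sum ?F) < degree f"
      using False by (metis le_neq_implies_less leading_coeff_0_iff degree_0)
    from less[OF this] obtain G where "shift_sum G = f - shift_sum ?F" by blast
    then have "shift_sum (G + ?F) = f" by (simp add: shift_sum_add)
    then show ?thesis ..
  qed
qed

text \<open>The derivative at 0 of the preimage. Its value on \<open>v^k\<close> is half of the derivative at 0 of the \<open>k\<close>-th
  Euler polynomial, which is half a Genocchi number.\<close>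

definition genocchi_functional :: "complex poly \<Rightarrow> complex" where
  "genocchi_functional f = coeff (THE F. shift_sum F = f) 1"

lemma genocchi_shift_sum: "genocchi_functional (shift_sum F) = coeff F 1"
proof -
  have "(THE G. shift_sum G = shift_sum F) = F"
  proof (rule the_equality)
    fix G assume "shift_sum G = shift_sum F"
    then have "shift_sum (G + smult (-1) F) = 0"
      unfolding shift_sum_add shift_sum_smult by simp
    then show "G = F" by (simp add: shift_sum_eq_0_iff)
  qed simp
  then show ?thesis by (simp add: genocchi_functional_def)
qed

lemma genocchi_add: "genocchi_functional (f + g) = genocchi_functional f + genocchi_functional g"
proof -
  obtain F G where "f = shift_sum F" "g = shift_sum G" using shift_sum_surj by metis
  then show ?thesis by (simp add: genocchi_shift_sum flip: shift_sum_add)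
qed

lemma genocchi_smult: "genocchi_functional (smult c f) = c * genocchi_functional f"
proof -
  obtain F where "f = shift_sum F" using shift_sum_surj by metis
  then show ?thesis by (simp add: genocchi_shift_sum flip: shift_sum_smult)
qed

lemma genocchi_0: "genocchi_functional 0 = 0"
  using genocchi_smult[of 0 0] by simp

lemma genocchi_sum: "genocchi_functional (\<Sum>i\<in>A. f i) = (\<Sum>i\<in>A. genocchi_functional (f i))"
  by (induction A rule: infinite_finite_induct) (simp_all add: genocchi_0 genocchi_add)

text \<open>The substitution \<open>v \<mapsto> -1 - v\<close> corresponds to \<open>v \<mapsto> -v\<close> on the preimage, whose derivative at 0 changes
  sign.\<close>

lemma genocchi_reflect: "genocchi_functional (pcompose f [:-1, -1:]) = - genocchi_functional f"
proof -
  obtain F where F: "f = shift_sum F" using shift_sum_surj by metis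
  have "pcompose f [:-1, -1:] = shift_sum (pcompose F [:0, -1:])"
    unfolding F shift_sum_def by (simp add: pcompose_add pcompose_assoc[symmetric] pcompose_pCons)
  moreover have "coeff (pcompose F [:0, -1:]) 1 = - coeff F 1"
    by (simp add: coeff_pcompose_linear)
  ultimately show ?thesis by (simp add: F genocchi_shift_sum)
qed

definition genocchi_moment :: "nat \<Rightarrow> nat \<Rightarrow> complex" where
  "genocchi_moment a b = genocchi_functional ([:0, 1:] ^ a * [:1, 1:] ^ b)"

lemma moment_rec: "genocchi_moment a (Suc b) = genocchi_moment (Suc a) b + genocchi_moment a b"
proof -
  have "[:0, 1:] ^ a * [:1, 1:] ^ Suc b =
    [:0, 1:] ^ Suc a * [:1, 1:] ^ b + ([:0, 1:] ^ a * [:1, 1:] ^ b :: complex poly)"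
    by (simp add: algebra_simps)
  then show ?thesis unfolding genocchi_moment_def by (simp add: genocchi_add)
qed

lemma moment_reflect: "genocchi_moment a b = (-1) ^ (a + b + 1) * genocchi_moment b a"
proof -
  have "pcompose ([:0, 1:] ^ a * [:1, 1:] ^ b) [:-1, -1:]
     = smult ((-1) ^ (a + b)) ([:0, 1:] ^ b * [:1, 1:] ^ a :: complex poly)"
  proof -
    have "pcompose [:0, 1:] [:-1, -1:] = smult (-1) [:1, 1::complex:]"
      "pcompose [:1, 1:] [:-1, -1:] = smult (-1) [:0, 1::complex:]"
      by (simp_all add: pcompose_pCons)
    then show ?thesis
      unfolding pcompose_mult pcompose_power
      by (simp only: smult_power mult_smult_left mult_smult_right smult_smult power_add mult.commute)
  qed
  then have "- genocchi_moment a b = (-1) ^ (a + b) * genocchi_moment b a"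
    unfolding genocchi_moment_def by (metis genocchi_reflect genocchi_smult)
  then have "genocchi_moment a b = - ((-1) ^ (a + b) * genocchi_moment b a)" by (metis minus_minus)
  then show ?thesis by simp
qed

lemma moment_diag: "genocchi_moment a a = 0"
  using moment_reflect[of a a] by (simp flip: mult_2)

text \<open>The functional vanishes on \<open>v^k + (v + 1)^k\<close> for \<open>k \<ge> 2\<close>; for odd \<open>k\<close> the two summands
  have the same value by reflection.\<close>

lemma moment_odd_0:
  assumes "p \<ge> 1"
  shows "genocchi_moment (2 * p + 1) 0 = 0"
proof -
  let ?F = "[:0, 1:] ^ (2 * p + 1) :: complex poly"
  have "shift_sum ?F = ?F + [:1, 1:] ^ (2 * p + 1)"
    by (simp add: shift_sum_def pcompose_pCons pcompose_mult pcompose_power)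
  moreover have "coeff ?F 1 = 0" using assms by (cases p) simp_all
  ultimately have "genocchi_moment (2 * p + 1) 0 + genocchi_moment 0 (2 * p + 1) = 0"
    using genocchi_shift_sum[of ?F] by (simp add: genocchi_moment_def genocchi_add)
  moreover have "genocchi_moment (2 * p + 1) 0 = genocchi_moment 0 (2 * p + 1)"
    by (subst moment_reflect) simp
  ultimately show ?thesis by simp
qed

lemma moment_1_0: "genocchi_moment 1 0 = 1 / 2"
proof -
  have "shift_sum [:-1/4, 1/2:] = [:0, 1:]" by (simp add: shift_sum_def pcompose_pCons)
  then show ?thesis using genocchi_shift_sum[of "[:-1/4, 1/2:]"] by (simp add: genocchi_moment_def)
qed

text \<open>Row \<open>i\<close> of the triangle consists of the moments of total degree \<open>i + 1\<close>. Pascal's rule for the moments is the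
  rule of the triangle, and its two boundary zeros are \<open>moment_odd_0\<close> and \<open>moment_diag\<close>.\<close>

lemma seidel_moment:
  assumes "p \<ge> 1" "1 \<le> j" "j \<le> p + 1"
  shows "complex_of_nat (seidel (2 * p) j) = (-1) ^ p * 2 * genocchi_moment (p + j) (p + 1 - j)"
proof -
  have even_row: "complex_of_nat (seidel (2 * p) j) = (-1) ^ p * 2 * genocchi_moment (p + j) (p + 1 - j)"
    if p: "p \<ge> 1" and j: "1 \<le> j" "j \<le> p + 1"
      and odd_row: "\<And>j. 1 \<le> j \<Longrightarrow> j \<le> p \<Longrightarrow>
        complex_of_nat (seidel (2 * p - 1) j) = (-1) ^ p * 2 * genocchi_moment (p + j) (p - j)"
    for p j
    using j(2,1)
  proof (induction j rule: inc_induct)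
    case base
    then show ?case using moment_odd_0[OF p] by (subst seidel.simps) (simp add: mult_2)
  next
    case (step j)
    then have "complex_of_nat (seidel (2 * p) j) = complex_of_nat (seidel (2 * p - 1) j) + complex_of_nat (seidel (2 * p) (Suc j))"
      using p by (subst seidel.simps) auto
    also have "\<dots> = (-1) ^ p * 2 * (genocchi_moment (p + j) (p - j)
        + genocchi_moment (Suc (p + j)) (p - j))"
      using step odd_row[of j] by (simp add: algebra_simps)
    also have "\<dots> = (-1) ^ p * 2 * genocchi_moment (p + j) (p + 1 - j)"
      using step moment_rec[of "p + j" "p - j"] by (simp add: Suc_diff_le)
    finally show ?case .
  qed
  have odd_row: "complex_of_nat (seidel (2 * p + 1) j) = (-1) ^ (p + 1) * 2 * genocchi_moment (p + 1 + j) (p + 1 - j)"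
    if p: "p \<ge> 1" and j: "j \<le> p + 1"
      and even_row: "\<And>j. 1 \<le> j \<Longrightarrow> j \<le> p + 1 \<Longrightarrow>
        complex_of_nat (seidel (2 * p) j) = (-1) ^ p * 2 * genocchi_moment (p + j) (p + 1 - j)"
    for p j
    using j
  proof (induction j)
    case 0
    then show ?case by (subst seidel.simps) (simp add: moment_diag)
  next
    case (Suc j)
    then have "complex_of_nat (seidel (2 * p + 1) (Suc j)) = complex_of_nat (seidel (2 * p + 1) j) + complex_of_nat (seidel (2 * p) (Suc j))"
      using p by (subst seidel.simps) auto
    also have "\<dots> = (-1) ^ (p + 1) * 2 * (genocchi_moment (p + 1 + j) (p + 1 - j)
        - genocchi_moment (p + 1 + j) (p - j))"
      using Suc even_row[of "Suc j"] by (simp add: algebra_simps)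
    also have "\<dots> = (-1) ^ (p + 1) * 2 * genocchi_moment (p + 1 + Suc j) (p + 1 - Suc j)"
      using Suc moment_rec[of "p + 1 + j" "p - j"] by (simp add: Suc_diff_le)
    finally show ?case .
  qed
  have "\<forall>j. 1 \<le> j \<longrightarrow> j \<le> p + 1 \<longrightarrow>
      complex_of_nat (seidel (2 * p) j) = (-1) ^ p * 2 * genocchi_moment (p + j) (p + 1 - j)"
    using assms(1)
  proof (induction p rule: dec_induct)
    case base
    have "genocchi_moment 2 0 = - genocchi_moment 1 0"
      using moment_rec[of 1 0] moment_diag[of 1] by (simp add: numeral_2_eq_2 add_eq_0_iff2)
    then have "genocchi_moment 2 0 = - 1 / 2" by (simp add: moment_1_0[unfolded One_nat_def])
    moreover have "seidel 1 1 = 1" by (subst seidel.simps) simp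
    ultimately have "complex_of_nat (seidel (2 * 1 - 1) j) = (-1) ^ 1 * 2 * genocchi_moment (1 + j) (1 - j)"
      if "1 \<le> j" "j \<le> 1" for j
      using that by (cases "j = 1") (simp_all add: numeral_2_eq_2)
    then show ?case using even_row[of 1] by blast
  next
    case (step p)
    then show ?case using even_row[of "Suc p"] odd_row[of p] by simp
  qed
  then show ?thesis using assms by blast
qed

section \<open>The linear coefficient\<close>

definition linear_coeff :: "nat \<Rightarrow> nat \<Rightarrow> complex" where
  "linear_coeff n i = coeff (transfer_poly n i) 1"

text \<open>Leaving the state \<open>i = 0\<close> costs a factor \<open>l\<close>, and staying there costs \<open>l^2\<close>.\<close>

lemma coeff_0_transfer_poly: "n \<ge> 1 \<Longrightarrow> coeff (transfer_poly n i) 0 = 0"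
proof (induction n arbitrary: i rule: dec_induct)
  case base
  then show ?case by (cases i) (simp_all add: coeff_mult)
next
  case (step n)
  then show ?case by (cases i) (simp_all add: coeff_mult)
qed

lemma linear_coeff_1: "linear_coeff 1 i = (if i = 1 then 1 else 0)"
  by (cases i) (auto simp: linear_coeff_def coeff_pCons split: nat.splits)

lemma linear_coeff_Suc:
  assumes "n \<ge> 1"
  shows "linear_coeff (Suc n) (Suc j)
    = of_nat (Suc j) * of_nat j / 2 * (linear_coeff n (Suc j) - linear_coeff n j)"
  using coeff_0_transfer_poly[OF assms]
  by (simp add: linear_coeff_def coeff_mult field_simps)

lemma linear_coeff_0:
  assumes "n \<ge> 1"
  shows "linear_coeff n 0 = 0"
  using assms coeff_0_transfer_poly
  by (induction n rule: dec_induct) (simp_all add: linear_coeff_def coeff_mult)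

text \<open>The polynomial \<open>v (v + 1) / 2\<close>.\<close>

definition tri :: "complex poly" where "tri = [:0, 1/2, 1/2:]"

text \<open>Up to sign and scaling, \<open>tri_basis j\<close> is the product of \<open>v + s\<close> for \<open>-j < s \<le> j\<close>. The scaling is chosen such that
  multiplication by \<open>tri\<close> has the same coefficients as the recursion \<open>linear_coeff_Suc\<close>, with
  \<open>i = j + 1\<close>.\<close>

fun tri_basis :: "nat \<Rightarrow> complex poly" where
  "tri_basis 0 = 1"
| "tri_basis (Suc j) = smult (1 / (of_nat (Suc (Suc j)) * of_nat (Suc j))) ([:of_nat j * of_nat (j + 1), -1, -1:] * tri_basis j)"

lemma tri_mult_basis: "tri * tri_basis j
    = smult (of_nat (Suc j) * of_nat j / 2) (tri_basis j) - smult (of_nat (Suc (Suc j)) * of_nat (Suc j) / 2) (tri_basis (Suc j))"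
proof -
  have gen: "d / 2 * (1 / d) = 1 / 2" if "d \<noteq> 0" for d :: complex using that by simp
  have nz: "complex_of_nat (Suc (Suc j)) * of_nat (Suc j) \<noteq> 0"
    unfolding mult_eq_0_iff of_nat_eq_0_iff by simp
  have "smult (of_nat (Suc (Suc j)) * of_nat (Suc j) / 2) (tri_basis (Suc j)) = smult (1/2) ([:of_nat j * of_nat (j + 1), -1, -1:] * tri_basis j)"
    by (simp only: tri_basis.simps smult_smult gen[OF nz])
  also have "\<dots> = smult (of_nat (Suc j) * of_nat j / 2) (tri_basis j) - tri * tri_basis j"
  proof -
    have "smult (1/2) [:of_nat j * of_nat (j + 1), -1, -1:] = [:of_nat (Suc j) * of_nat j / 2:] - tri"
      by (simp add: tri_def algebra_simps)
    then show ?thesis by (simp only: mult_smult_left[symmetric] left_diff_distrib) simp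
  qed
  finally show ?thesis by simp
qed

lemma tri_power: "tri ^ n = (\<Sum>j\<le>n. smult (linear_coeff (Suc n) (Suc j)) (tri_basis j))"
proof (induction n)
  case 0
  then show ?case using linear_coeff_1[of 1] by (simp add: one_pCons)
next
  case (Suc n)
  let ?a = "\<lambda>i. linear_coeff (Suc n) i" and ?c = "\<lambda>j. of_nat (Suc j) * of_nat j / 2 :: complex"
  have z: "?a (Suc (Suc n)) = 0" by (simp only: linear_coeff_def transfer_poly_eq_0 lessI coeff_0)
  have "tri ^ Suc n = (\<Sum>j\<le>n. smult (?a (Suc j)) (tri * tri_basis j))"
    unfolding power_Suc Suc.IH sum_distrib_left by simp
  also have "\<dots> = (\<Sum>j\<le>n. smult (?c j * ?a (Suc j)) (tri_basis j)) - (\<Sum>j\<le>n. smult (?c (Suc j) * ?a (Suc j)) (tri_basis (Suc j)))"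
    unfolding tri_mult_basis sum_subtractf[symmetric]
    by (intro sum.cong refl) (simp only: smult_diff_right smult_smult mult.commute)
  also have "(\<Sum>j\<le>n. smult (?c j * ?a (Suc j)) (tri_basis j)) = (\<Sum>j\<le>Suc n. smult (?c j * ?a (Suc j)) (tri_basis j))"
    using z by simp
  also have "(\<Sum>j\<le>n. smult (?c (Suc j) * ?a (Suc j)) (tri_basis (Suc j))) = (\<Sum>j\<le>Suc n. smult (?c j * ?a j) (tri_basis j))"
    unfolding sum.atMost_Suc_shift[of _ n] by (simp del: tri_basis.simps of_nat_Suc)
  also have "(\<Sum>j\<le>Suc n. smult (?c j * ?a (Suc j)) (tri_basis j)) - (\<Sum>j\<le>Suc n. smult (?c j * ?a j) (tri_basis j))
     = (\<Sum>j\<le>Suc n. smult (linear_coeff (Suc (Suc n)) (Suc j)) (tri_basis j))"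
    unfolding sum_subtractf[symmetric]
  proof (intro sum.cong refl)
    fix j
    have "linear_coeff (Suc (Suc n)) (Suc j) = ?c j * (?a (Suc j) - ?a j)"
      by (rule linear_coeff_Suc) simp
    then show "smult (?c j * ?a (Suc j)) (tri_basis j) - smult (?c j * ?a j) (tri_basis j)
      = smult (linear_coeff (Suc (Suc n)) (Suc j)) (tri_basis j)"
      by (simp only: right_diff_distrib smult_diff_left)
  qed
  finally show ?case .
qed

text \<open>The preimage under \<open>shift_sum\<close> is again a product of consecutive linear factors,
  \<open>F j = (v - j) * tri_basis j\<close>: its shift is \<open>(v + j + 1) * tri_basis j\<close>, and the two factors add up to \<open>2 v + 1\<close>.\<close>

lemma genocchi_tri_basis: "genocchi_functional ([:1, 2:] * tri_basis j) = 1 / of_nat (Suc j)"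
proof -
  define F where "F j = [:- of_nat j, 1:] * tri_basis j" for j
  let ?k = "\<lambda>j. 1 / (complex_of_nat (Suc (Suc j)) * of_nat (Suc j))"
  have F_Suc: "F (Suc j) = smult (?k j) ([:of_nat (Suc j) ^ 2, 0, -1:] * F j)" for j
  proof -
    have "[:- of_nat (Suc j), 1:] * [:of_nat j * of_nat (j + 1), -1, -1:]
       = [:of_nat (Suc j) ^ 2, 0, -1:] * [:- of_nat j, 1 :: complex:]"
      by (simp add: power2_eq_square algebra_simps)
    then show ?thesis
      unfolding F_def tri_basis.simps mult_smult_right by (simp only: mult.assoc[symmetric])
  qed
  have shift: "pcompose (F j) [:1, 1:] = [:of_nat (Suc j), 1:] * tri_basis j" for j
  proof (induction j)
    case 0
    then show ?case by (simp add: F_def pcompose_pCons)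
  next
    case (Suc j)
    have "pcompose [:of_nat (Suc j) ^ 2, 0, -1:] [:1, 1:] * [:of_nat (Suc j), 1:]
       = [:of_nat (Suc (Suc j)), 1:] * [:of_nat j * of_nat (j + 1), -1, -1 :: complex:]"
      by (simp add: pcompose_pCons power2_eq_square algebra_simps)
    then show ?case
      unfolding F_Suc tri_basis.simps pcompose_smult pcompose_mult Suc.IH mult_smult_right
      by (simp only: mult.assoc[symmetric])
  qed
  have "shift_sum (F j) = ([:- of_nat j, 1:] + [:of_nat (Suc j), 1:]) * tri_basis j"
    unfolding shift_sum_def shift by (simp only: F_def distrib_right)
  then have "shift_sum (F j) = [:1, 2:] * tri_basis j" by simp
  moreover have "coeff (F j) 0 = 0 \<and> coeff (F j) 1 = 1 / of_nat (Suc j)"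
  proof (induction j)
    case 0
    then show ?case by (simp add: F_def)
  next
    case (Suc j)
    have nz: "complex_of_nat (Suc j) \<noteq> 0" "complex_of_nat (Suc (Suc j)) \<noteq> 0"
      unfolding of_nat_eq_0_iff by simp_all
    have "coeff (F (Suc j)) 1 = ?k j * (of_nat (Suc j) ^ 2 * coeff (F j) 1)"
      unfolding F_Suc by (simp add: coeff_mult)
    also have "\<dots> = 1 / of_nat (Suc (Suc j))"
      using Suc.IH nz by (simp add: power2_eq_square del: of_nat_Suc)
    finally have "coeff (F (Suc j)) 1 = 1 / of_nat (Suc (Suc j))" .
    moreover have "coeff (F (Suc j)) 0 = 0" using Suc.IH unfolding F_Suc by (simp add: coeff_mult)
    ultimately show ?case by (rule conjI[rotated])
  qed
  ultimately show ?thesis by (metis genocchi_shift_sum)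
qed

lemma genocchi_tri_mult_basis: "genocchi_functional ([:1, 2:] * (tri * tri_basis j)) = - 1 / 2"
proof -
  have nz: "complex_of_nat (Suc j) \<noteq> 0" "complex_of_nat (Suc (Suc j)) \<noteq> 0"
    unfolding of_nat_eq_0_iff by simp_all
  let ?c = "of_nat (Suc j) * of_nat j / 2 :: complex" and ?d = "of_nat (Suc (Suc j)) * of_nat (Suc j) / 2 :: complex"
  have "[:1, 2:] * (tri * tri_basis j) = smult ?c ([:1, 2:] * tri_basis j) + smult (- ?d) ([:1, 2:] * tri_basis (Suc j))"
    unfolding tri_mult_basis by (simp only: diff_conv_add_uminus distrib_left mult_smult_right mult_minus_right smult_minus_left)
  then have "genocchi_functional ([:1, 2:] * (tri * tri_basis j))
     = ?c * (1 / of_nat (Suc j)) - ?d * (1 / of_nat (Suc (Suc j)))"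
    by (simp only: genocchi_add genocchi_smult genocchi_tri_basis) simp
  also have "\<dots> = - 1 / 2"
    using nz by (simp add: divide_simps del: of_nat_Suc) (simp add: algebra_simps)
  finally show ?thesis .
qed

text \<open>By \<open>tri_power\<close> and \<open>genocchi_tri_mult_basis\<close>, the sum is, up to a factor \<open>-2\<close>, the Genocchi functional of
  \<open>(2 v + 1) (v (v + 1) / 2)^(n+1)\<close>; writing \<open>2 v + 1 = v + (v + 1)\<close>, this is a sum of two moments that
  are equal by reflection and lie in the middle of the Seidel triangle.\<close>

lemma sum_linear_coeff:
  "2 ^ n * (\<Sum>i\<le>Suc n. linear_coeff (Suc n) i) = (-1) ^ n * of_nat (median_genocchi n)"
proof -
  have "[:1, 2:] * (tri * tri ^ n) = (\<Sum>j\<le>n. smult (linear_coeff (Suc n) (Suc j)) ([:1, 2:] * (tri * tri_basis j)))"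
    unfolding tri_power sum_distrib_left by simp
  then have "genocchi_functional ([:1, 2:] * (tri * tri ^ n)) = (\<Sum>j\<le>n. linear_coeff (Suc n) (Suc j) * (- 1 / 2))"
    by (simp only: genocchi_sum genocchi_smult genocchi_tri_mult_basis)
  also have "\<dots> = (- 1 / 2) * (\<Sum>i\<le>Suc n. linear_coeff (Suc n) i)"
    unfolding sum.atMost_Suc_shift[of _ n] by (simp add: linear_coeff_0 sum_distrib_left mult.commute)
  finally have 1: "genocchi_functional ([:1, 2:] * (tri * tri ^ n)) = (- 1 / 2) * (\<Sum>i\<le>Suc n. linear_coeff (Suc n) i)" .
  have "[:1, 2:] * (tri * tri ^ n) = smult ((1/2) ^ Suc n)
     ([:0, 1:] ^ (n + 2) * [:1, 1:] ^ (n + 1) + [:0, 1:] ^ (n + 1) * [:1, 1:] ^ (n + 2))"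
  proof -
    have tri: "tri = smult (1/2) ([:0, 1:] * [:1, 1:])" by (simp add: tri_def)
    have "tri * tri ^ n = (smult (1/2) ([:0, 1:] * [:1, 1:])) ^ Suc n"
      unfolding tri[symmetric] by simp
    also have "\<dots> = smult ((1/2) ^ Suc n) ([:0, 1:] ^ Suc n * [:1, 1:] ^ Suc n)"
      unfolding smult_power power_mult_distrib ..
    finally have "tri * tri ^ n = smult ((1/2) ^ Suc n) ([:0, 1:] ^ Suc n * [:1, 1:] ^ Suc n)" .
    moreover have "[:1, 2:] = [:0, 1:] + [:1, 1 :: complex:]" by simp
    moreover have "(X + Y) * (X ^ Suc n * Y ^ Suc n) = X ^ (n + 2) * Y ^ (n + 1) + X ^ (n + 1) * Y ^ (n + 2)"
      for X Y :: "complex poly" by (simp add: algebra_simps)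
    ultimately show ?thesis by (simp only: mult_smult_right)
  qed
  then have "genocchi_functional ([:1, 2:] * (tri * tri ^ n))
    = (1/2) ^ Suc n * (genocchi_moment (n + 2) (n + 1) + genocchi_moment (n + 1) (n + 2))"
    by (simp only: genocchi_smult genocchi_add genocchi_moment_def)
  also have "genocchi_moment (n + 1) (n + 2) = genocchi_moment (n + 2) (n + 1)"
    by (subst moment_reflect) simp
  also have "(1/2) ^ Suc n * (genocchi_moment (n + 2) (n + 1) + genocchi_moment (n + 2) (n + 1))
     = (1/2) ^ Suc n * ((-1) ^ Suc n * of_nat (median_genocchi n))"
  proof -
    have "of_nat (seidel (2 * Suc n) 1) = (-1) ^ Suc n * 2 * genocchi_moment (Suc n + 1) (Suc n + 1 - 1)"
      by (rule seidel_moment) auto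
    then have "of_nat (median_genocchi n) = (-1) ^ Suc n * (2 * genocchi_moment (n + 2) (n + 1))"
      by (simp add: median_genocchi_def)
    then have "(-1) ^ Suc n * of_nat (median_genocchi n) = 2 * genocchi_moment (n + 2) (n + 1)"
      by simp
    then show ?thesis by simp
  qed
  finally have "(- 1 / 2) * (\<Sum>i\<le>Suc n. linear_coeff (Suc n) i) = (1/2) ^ Suc n * ((-1) ^ Suc n * of_nat (median_genocchi n))"
    unfolding 1 .
  then show ?thesis by (simp add: power_one_over field_simps del: sum.atMost_Suc)
qed

text \<open>The substitution \<open>x = l + l^2\<close> is the identity modulo \<open>l^2\<close>.\<close>

lemma coeff_pcompose_quadratic:
  "coeff (pcompose q [:0, 1, 1:]) 0 = coeff q 0" "coeff (pcompose q [:0, 1, 1:]) 1 = coeff q 1"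
  for q :: "complex poly"
proof -
  obtain a b r where "q = pCons a (pCons b r)" by (metis pCons_cases)
  then show "coeff (pcompose q [:0, 1, 1:]) 0 = coeff q 0" "coeff (pcompose q [:0, 1, 1:]) 1 = coeff q 1"
    by (simp_all add: pcompose_pCons)
qed

theorem mainTheorem2:
  fixes n :: nat
  assumes "n \<ge> 1"
  shows "[:0, 1:] ^ 2 dvd
    D_poly n - smult ((-1) ^ (n - 1) * int (normalized_median_genocchi (n - 1))) [:0, 1:]"
proof -
  obtain m where n: "n = Suc m" using assms by (cases n) auto
  obtain p where p: "weight_value (complete_diagram n) p"
    using weight_value_exists[OF chord_diagram_complete assms] by blast
  have D: "D_poly n = p"
    unfolding D_poly_def weight_def using p weight_value_unique by blast
  let ?q = "map_poly of_int p :: complex poly"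
  have "poly (pcompose ?q [:0, 1, 1:]) l = poly (\<Sum>i\<le>n. transfer_poly n i) l" for l
    using eval_weight_value_complete[OF p, of l]
    by (simp add: poly_pcompose poly_sum eval_int_poly_def algebra_simps)
  then have q: "pcompose ?q [:0, 1, 1:] = (\<Sum>i\<le>n. transfer_poly n i)"
    by (intro iffD1[OF poly_eq_poly_eq_iff] ext)
  have "of_int (coeff p 0) = (0 :: complex)"
    using coeff_pcompose_quadratic(1)[of ?q] coeff_0_transfer_poly[OF assms]
    unfolding q by (simp add: coeff_sum coeff_map_poly del: sum.atMost_Suc)
  then have c0: "coeff p 0 = 0" by simp
  have "of_int (coeff p 1) = (\<Sum>i\<le>n. linear_coeff n i)"
    using coeff_pcompose_quadratic(2)[of ?q]
    unfolding q linear_coeff_def by (simp add: coeff_sum coeff_map_poly)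
  then have "(of_int (2 ^ m * coeff p 1) :: complex) = of_int ((-1) ^ m * int (median_genocchi m))"
    using sum_linear_coeff[of m] unfolding n by simp
  then have "2 ^ m * coeff p 1 = (-1) ^ m * int (median_genocchi m)"
    by (simp only: of_int_eq_iff)
  then have "int (median_genocchi m) = (-1) ^ m * (2 ^ m * coeff p 1)" by simp
  then have "int (median_genocchi m) = 2 ^ m * ((-1) ^ m * coeff p 1)" by (simp only: mult.left_commute)
  then have "int (median_genocchi m div 2 ^ m) = (-1) ^ m * coeff p 1"
    by (simp add: zdiv_int)
  then have c1: "coeff p 1 = (-1) ^ m * int (normalized_median_genocchi m)"
    unfolding normalized_median_genocchi_def by simp
  obtain a b r where r: "p = pCons a (pCons b r)" by (metis pCons_cases)
  then have "p - smult (coeff p 1) [:0, 1:] = [:0, 1:] ^ 2 * r"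
    using c0 by (simp add: power2_eq_square)
  then show ?thesis
    unfolding D unfolding n diff_Suc_1 c1[symmetric] by simp
qed

end
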